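(* Let $\lambda,\mu,\nu>0$, let $K$ be a positive integer and $0<M\le K$. For $n\in\mathbb{N}$ let $(Q^n(\cdot),Z^n(\cdot))$ be the charging-station process with arrival rate $n\lambda$, $nK$ parking spaces, power capacity $nM$, and unscaled rates $\mu,\nu$. If $\frac{Z^n(0)}{n}\overset{d}{\to}z(0)$ for a constant $z(0)\in[0,K]$ and $\frac{Q^n(0)}{n}\overset{d}{\to}K$ as $n\to\infty$, then $\frac{Z^n(\cdot)}{n}\overset{d}{\to}z(\cdot)$ as $n\to\infty$, where $z(\cdot)$ is a deterministic continuous function with values in $[0,K]$ and initial value $z(0)$ that satisfies $$z'(t)=\min\{\lambda,\nu K\}-\nu z(t)-\mu\min\{z(t),M\}.$$
   Context: Charging-station process with arrival rate $\lambda^n$, $K^n$ spaces and capacity $M^n$: $(Q^n,Z^n)$ is the continuous-time Markov chain on $\{0\le z\le q\le K^n\}$ with transitions $(q,z)\to(q+1,z+1)$ at rate $\lambda^n$ if $q<K^n$; $(q,z)\to(q,z-1)$ at rate $\mu\min\{z,M^n\}$; $(q,z)\to(q-1,z-1)$ at rate $\nu z$; $(q,z)\to(q-1,z)$ at rate $\nu(q-z)$. It is assumed that $\mathbb{E}[Q^n(0)]$ and $\mathbb{E}[Z^n(0)]$ are finite. $\overset{d}{\to}$ for processes denotes weak convergence in the Skorokhod space $\mathcal{D}[0,T]$ with the $J_1$ topology, for every $T>0$. *)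

theory Defs
  imports "HOL-Probability.Probability"
begin

section \<open>Cadlag functions and the Skorokhod space\<close>

text \<open>The filter \<^term>\<open>at t within A \<inter> {..<t}\<close> is trivial when \<open>t\<close> is the left end point of \<open>A\<close>, so that
  no left limit is demanded there; likewise for right-continuity at the right end point.\<close>

definition cadlag_on :: "real set \<Rightarrow> (real \<Rightarrow> 'b::topological_space) \<Rightarrow> bool" where
  "cadlag_on A x \<longleftrightarrow>
     (\<forall>t\<in>A. (x \<longlongrightarrow> x t) (at t within A \<inter> {t<..}) \<and>
            (\<exists>l. (x \<longlongrightarrow> l) (at t within A \<inter> {..<t})))"

definition skorokhod_space :: "real \<Rightarrow> (real \<Rightarrow> real) set" where
  "skorokhod_space T = {x \<in> extensional {0..T}. cadlag_on {0..T} x}"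

definition time_changes :: "real \<Rightarrow> (real \<Rightarrow> real) set" where
  "time_changes T =
     {\<theta>. strict_mono_on {0..T} \<theta> \<and> continuous_on {0..T} \<theta> \<and> \<theta> ` {0..T} = {0..T}}"

definition skorokhod_close :: "real \<Rightarrow> (real \<Rightarrow> real) \<Rightarrow> (real \<Rightarrow> real) \<Rightarrow> real \<Rightarrow> bool" where
  "skorokhod_close T x y e \<longleftrightarrow>
     (\<exists>\<theta>\<in>time_changes T. \<forall>t\<in>{0..T}. \<bar>\<theta> t - t\<bar> \<le> e \<and> \<bar>x t - y (\<theta> t)\<bar> \<le> e)"

text \<open>Skorokhod's \<open>J\<^sub>1\<close> metric.  The value outside the space is irrelevant; it is fixed because
  \<^locale>\<open>Metric_space\<close> asks for nonnegativity and symmetry on the whole type.\<close>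

definition skorokhod_dist :: "real \<Rightarrow> (real \<Rightarrow> real) \<Rightarrow> (real \<Rightarrow> real) \<Rightarrow> real" where
  "skorokhod_dist T x y =
     (if x \<in> skorokhod_space T \<and> y \<in> skorokhod_space T
      then Inf {e. 0 < e \<and> skorokhod_close T x y e} else 0)"

definition skorokhod_topology :: "real \<Rightarrow> (real \<Rightarrow> real) topology" where
  "skorokhod_topology T = Metric_space.mtopology (skorokhod_space T) (skorokhod_dist T)"

definition borel_on :: "'b topology \<Rightarrow> 'b measure" where
  "borel_on X = sigma (topspace X) {U. openin X U}"

lemma cadlag_on_bounded:
  fixes x :: "real \<Rightarrow> real"
  assumes "cadlag_on {0..T} x"
  shows "\<exists>B. \<forall>t\<in>{0..T}. \<bar>x t\<bar> \<le> B"
proof -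
  have loc: "\<exists>U B. open U \<and> t \<in> U \<and> (\<forall>s\<in>U \<inter> {0..T}. \<bar>x s\<bar> \<le> B)" if t: "t \<in> {0..T}" for t
  proof -
    from assms t obtain l where r: "(x \<longlongrightarrow> x t) (at t within {0..T} \<inter> {t<..})"
      and l: "(x \<longlongrightarrow> l) (at t within {0..T} \<inter> {..<t})"
      unfolding cadlag_on_def by blast
    from tendstoD[OF r, of 1] obtain U where U: "open U" "t \<in> U"
      "\<And>s. s \<in> U \<Longrightarrow> s \<noteq> t \<Longrightarrow> s \<in> {0..T} \<inter> {t<..} \<Longrightarrow> dist (x s) (x t) < 1"
      unfolding eventually_at_topological by auto
    from tendstoD[OF l, of 1] obtain V where V: "open V" "t \<in> V"
      "\<And>s. s \<in> V \<Longrightarrow> s \<noteq> t \<Longrightarrow> s \<in> {0..T} \<inter> {..<t} \<Longrightarrow> dist (x s) l < 1"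
      unfolding eventually_at_topological by auto
    have "\<bar>x s\<bar> \<le> \<bar>x t\<bar> + \<bar>l\<bar> + 1" if s: "s \<in> (U \<inter> V) \<inter> {0..T}" for s
    proof (cases s t rule: linorder_cases)
      case less
      with V(3)[of s] s show ?thesis by (auto simp: dist_real_def)
    next
      case greater
      with U(3)[of s] s show ?thesis by (auto simp: dist_real_def)
    qed auto
    with U V show ?thesis by (intro exI[of _ "U \<inter> V"]) blast
  qed
  then obtain U B where UB: "\<And>t. t \<in> {0..T} \<Longrightarrow> open (U t) \<and> t \<in> U t"
    "\<And>t s. t \<in> {0..T} \<Longrightarrow> s \<in> U t \<inter> {0..T} \<Longrightarrow> \<bar>x s\<bar> \<le> B t"
    by metis
  obtain C where C: "C \<subseteq> {0..T}" "finite C" "{0..T} \<subseteq> (\<Union>t\<in>C. U t)"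
    by (rule compactE_image[of "{0..T}" "{0..T}" U]) (use UB in auto)
  have "\<bar>x s\<bar> \<le> (\<Sum>t\<in>C. \<bar>B t\<bar>)" if s: "s \<in> {0..T}" for s
  proof -
    obtain t where t: "t \<in> C" "s \<in> U t" using C s by auto
    have "\<bar>x s\<bar> \<le> \<bar>B t\<bar>" using UB(2)[of t s] t s C by fastforce
    also have "\<dots> \<le> (\<Sum>t\<in>C. \<bar>B t\<bar>)" using t C by (intro member_le_sum) auto
    finally show ?thesis .
  qed
  then show ?thesis by blast
qed

lemma id_time_change: "(\<lambda>t. t) \<in> time_changes T"
  by (auto simp: time_changes_def strict_mono_on_def)

lemma time_change_comp:
  assumes "\<theta> \<in> time_changes T" "\<eta> \<in> time_changes T"
  shows "\<eta> \<circ> \<theta> \<in> time_changes T"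
proof -
  have "strict_mono_on {0..T} (\<eta> \<circ> \<theta>)"
  proof (rule strict_mono_onI)
    fix r s assume rs: "r \<in> {0..T}" "s \<in> {0..T}" "r < s"
    have "\<theta> r \<in> {0..T}" "\<theta> s \<in> {0..T}" using assms rs by (auto simp: time_changes_def)
    moreover have "\<theta> r < \<theta> s" using assms rs by (auto simp: time_changes_def strict_mono_on_def)
    ultimately show "(\<eta> \<circ> \<theta>) r < (\<eta> \<circ> \<theta>) s"
      using assms by (simp add: time_changes_def strict_mono_on_def)
  qed
  moreover have "continuous_on {0..T} (\<eta> \<circ> \<theta>)"
    by (rule continuous_on_compose) (use assms in \<open>simp_all add: time_changes_def\<close>)
  moreover have "(\<eta> \<circ> \<theta>) ` {0..T} = {0..T}"
    using assms unfolding time_changes_def by (simp only: mem_Collect_eq image_comp[symmetric])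
  ultimately show ?thesis by (simp add: time_changes_def)
qed

lemma time_change_inv:
  assumes "\<theta> \<in> time_changes T"
  shows "the_inv_into {0..T} \<theta> \<in> time_changes T"
proof -
  let ?g = "the_inv_into {0..T} \<theta>"
  have sm: "strict_mono_on {0..T} \<theta>" and c: "continuous_on {0..T} \<theta>"
    and im: "\<theta> ` {0..T} = {0..T}" using assms by (auto simp: time_changes_def)
  have inj: "inj_on \<theta> {0..T}" by (rule strict_mono_on_imp_inj_on[OF sm])
  have g: "?g s \<in> {0..T}" "\<theta> (?g s) = s" if "s \<in> {0..T}" for s
    using that the_inv_into_into[OF inj, of s "{0..T}"] f_the_inv_into_f[OF inj, of s]
    by (simp_all add: im)
  have "strict_mono_on {0..T} ?g"
  proof (rule strict_mono_onI)
    fix r s assume rs: "r \<in> {0..T}" "s \<in> {0..T}" "r < s"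
    show "?g r < ?g s"
    proof (rule ccontr)
      assume "\<not> ?g r < ?g s"
      then have "\<theta> (?g s) \<le> \<theta> (?g r)"
        by (intro strict_mono_on_leD[OF sm] g rs) simp
      then show False using g(2)[OF rs(1)] g(2)[OF rs(2)] rs(3) by simp
    qed
  qed
  moreover have "continuous_on (\<theta> ` {0..T}) ?g"
    by (rule continuous_on_inv[OF c]) (auto simp: the_inv_into_f_f[OF inj])
  moreover have "?g ` {0..T} = {0..T}"
    using the_inv_into_onto[OF inj] im by simp
  ultimately show ?thesis using im by (simp add: time_changes_def)
qed

lemma skorokhod_close_sym:
  assumes "skorokhod_close T x y e"
  shows "skorokhod_close T y x e"
proof -
  obtain \<theta> where th: "\<theta> \<in> time_changes T"
    "\<And>t. t \<in> {0..T} \<Longrightarrow> \<bar>\<theta> t - t\<bar> \<le> e \<and> \<bar>x t - y (\<theta> t)\<bar> \<le> e"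
    using assms by (auto simp: skorokhod_close_def)
  let ?g = "the_inv_into {0..T} \<theta>"
  have inj: "inj_on \<theta> {0..T}" and im: "\<theta> ` {0..T} = {0..T}"
    using th(1) strict_mono_on_imp_inj_on by (auto simp: time_changes_def)
  have "\<bar>?g s - s\<bar> \<le> e \<and> \<bar>y s - x (?g s)\<bar> \<le> e" if s: "s \<in> {0..T}" for s
  proof -
    have "?g s \<in> {0..T}" "\<theta> (?g s) = s"
      using s the_inv_into_into[OF inj, of s "{0..T}"] f_the_inv_into_f[OF inj, of s]
      by (simp_all add: im)
    then show ?thesis using th(2)[of "?g s"] by (simp add: abs_minus_commute)
  qed
  with time_change_inv[OF th(1)] show ?thesis unfolding skorokhod_close_def by blast
qed

lemma skorokhod_close_trans:
  assumes "skorokhod_close T x y e" "skorokhod_close T y z e'"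
  shows "skorokhod_close T x z (e + e')"
proof -
  obtain \<theta> where th: "\<theta> \<in> time_changes T"
    "\<And>t. t \<in> {0..T} \<Longrightarrow> \<bar>\<theta> t - t\<bar> \<le> e \<and> \<bar>x t - y (\<theta> t)\<bar> \<le> e"
    using assms by (auto simp: skorokhod_close_def)
  obtain \<eta> where et: "\<eta> \<in> time_changes T"
    "\<And>t. t \<in> {0..T} \<Longrightarrow> \<bar>\<eta> t - t\<bar> \<le> e' \<and> \<bar>y t - z (\<eta> t)\<bar> \<le> e'"
    using assms by (auto simp: skorokhod_close_def)
  have "\<bar>(\<eta> \<circ> \<theta>) t - t\<bar> \<le> e + e' \<and> \<bar>x t - z ((\<eta> \<circ> \<theta>) t)\<bar> \<le> e + e'" if t: "t \<in> {0..T}" for t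
  proof -
    have "\<theta> t \<in> {0..T}" using th(1) t by (auto simp: time_changes_def)
    with th(2)[OF t] et(2)[of "\<theta> t"] show ?thesis by (simp add: abs_le_iff)
  qed
  with time_change_comp[OF th(1) et(1)] show ?thesis
    unfolding skorokhod_close_def by blast
qed

lemma skorokhod_close_ex:
  assumes "x \<in> skorokhod_space T" "y \<in> skorokhod_space T"
  shows "\<exists>e. 0 < e \<and> skorokhod_close T x y e"
proof -
  obtain B C where "\<forall>t\<in>{0..T}. \<bar>x t\<bar> \<le> B" "\<forall>t\<in>{0..T}. \<bar>y t\<bar> \<le> C"
    using assms cadlag_on_bounded unfolding skorokhod_space_def by blast
  then have "\<forall>t\<in>{0..T}. \<bar>t - t\<bar> \<le> \<bar>B\<bar> + \<bar>C\<bar> + 1 \<and> \<bar>x t - y t\<bar> \<le> \<bar>B\<bar> + \<bar>C\<bar> + 1"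
    by fastforce
  then have "skorokhod_close T x y (\<bar>B\<bar> + \<bar>C\<bar> + 1)"
    unfolding skorokhod_close_def by (intro bexI[OF _ id_time_change])
  then show ?thesis by (intro exI[of _ "\<bar>B\<bar> + \<bar>C\<bar> + 1"]) auto
qed

lemma skorokhod_dist_lessD:
  assumes "x \<in> skorokhod_space T" "y \<in> skorokhod_space T" "skorokhod_dist T x y < d"
  obtains e where "0 < e" "e < d" "skorokhod_close T x y e"
proof -
  have "{e. 0 < e \<and> skorokhod_close T x y e} \<noteq> {}"
    using skorokhod_close_ex[OF assms(1,2)] by auto
  moreover have "Inf {e. 0 < e \<and> skorokhod_close T x y e} < d"
    using assms by (simp add: skorokhod_dist_def)
  ultimately obtain e where "e \<in> {e. 0 < e \<and> skorokhod_close T x y e}" "e < d"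
    using cInf_lessD by metis
  then show ?thesis by (intro that[of e]) auto
qed

lemma skorokhod_dist_le:
  assumes "x \<in> skorokhod_space T" "y \<in> skorokhod_space T" "0 < e" "skorokhod_close T x y e"
  shows "skorokhod_dist T x y \<le> e"
  using assms by (auto simp: skorokhod_dist_def intro!: cInf_lower bdd_belowI[of _ 0])

lemma skorokhod_dist_zeroD:
  assumes T: "0 \<le> T" and x: "x \<in> skorokhod_space T" and y: "y \<in> skorokhod_space T"
    and "skorokhod_dist T x y = 0"
  shows "x = y"
proof (rule extensionalityI[of _ "{0..T}"])
  show "x \<in> extensional {0..T}" "y \<in> extensional {0..T}"
    using x y by (auto simp: skorokhod_space_def)
  have near: "\<exists>\<theta>\<in>time_changes T. \<forall>t\<in>{0..T}. \<bar>\<theta> t - t\<bar> < e \<and> \<bar>x t - y (\<theta> t)\<bar> < e" if e: "0 < e" for e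
  proof -
    have "skorokhod_dist T x y < e" using e assms(4) by simp
    then obtain e' where e': "0 < e'" "e' < e" "skorokhod_close T x y e'"
      using skorokhod_dist_lessD[OF x y] by blast
    then obtain \<theta> where "\<theta> \<in> time_changes T"
      "\<forall>t\<in>{0..T}. \<bar>\<theta> t - t\<bar> \<le> e' \<and> \<bar>x t - y (\<theta> t)\<bar> \<le> e'"
      by (auto simp: skorokhod_close_def)
    then show ?thesis using e'(2) by (intro bexI[of _ \<theta>]) fastforce+
  qed
  fix t assume t: "t \<in> {0..T}"
  show "x t = y t"
  proof (cases "t < T")
    case False
    with t have tT: "t = T" by simp
    have "\<bar>x T - y T\<bar> < e" if e: "0 < e" for e
    proof -
      obtain \<theta> where th: "\<theta> \<in> time_changes T" "\<forall>t\<in>{0..T}. \<bar>\<theta> t - t\<bar> < e \<and> \<bar>x t - y (\<theta> t)\<bar> < e"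
        using near[OF e] by blast
      have "\<theta> T = T"
      proof -
        obtain s where s: "s \<in> {0..T}" "\<theta> s = T"
        proof -
          have "T \<in> \<theta> ` {0..T}" using th(1) T by (simp add: time_changes_def)
          then show ?thesis using that by auto
        qed
        have "\<theta> s \<le> \<theta> T" using th(1) s T strict_mono_on_leD[of "{0..T}" \<theta> s T]
          by (auto simp: time_changes_def)
        moreover have "\<theta> T \<in> {0..T}" using th(1) T by (auto simp: time_changes_def)
        ultimately show ?thesis using s by auto
      qed
      with th(2) T show ?thesis by (metis atLeastAtMost_iff order_refl)
    qed
    then show ?thesis using tT by (metis zero_less_abs_iff less_irrefl eq_iff_diff_eq_0)
  next
    case True
    have "\<bar>x t - y t\<bar> \<le> e" if e: "0 < e" for e
    proof -
      have rx: "(x \<longlongrightarrow> x t) (at t within {0..T} \<inter> {t<..})" and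
           ry: "(y \<longlongrightarrow> y t) (at t within {0..T} \<inter> {t<..})"
        using x y t by (auto simp: skorokhod_space_def cadlag_on_def)
      obtain d1 where d1: "0 < d1"
        "\<And>s. s \<in> {0..T} \<inter> {t<..} \<Longrightarrow> dist s t < d1 \<Longrightarrow> \<bar>x s - x t\<bar> < e/3"
        using tendstoD[OF rx, of "e/3"] e unfolding eventually_at by (auto simp: dist_real_def)
      obtain d2 where d2: "0 < d2"
        "\<And>s. s \<in> {0..T} \<inter> {t<..} \<Longrightarrow> dist s t < d2 \<Longrightarrow> \<bar>y s - y t\<bar> < e/3"
        using tendstoD[OF ry, of "e/3"] e unfolding eventually_at by (auto simp: dist_real_def)
      define m where "m = min (min d1 d2) (T - t)"
      have m: "0 < m" "m \<le> d1" "m \<le> d2" "m \<le> T - t" using d1 d2 True by (auto simp: m_def)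
      define s where "s = t + m / 2"
      obtain \<theta> where th: "\<theta> \<in> time_changes T"
        "\<forall>u\<in>{0..T}. \<bar>\<theta> u - u\<bar> < min (e/3) (m/3) \<and> \<bar>x u - y (\<theta> u)\<bar> < min (e/3) (m/3)"
        using near[of "min (e/3) (m/3)"] e m by auto
      have s: "s \<in> {0..T}" "t < s" "dist s t < d1"
        using m t by (auto simp: s_def dist_real_def)
      have th_s: "\<bar>\<theta> s - s\<bar> < m/3" "\<bar>x s - y (\<theta> s)\<bar> < e/3" using th(2) s by auto
      have "\<theta> s \<in> {0..T}" using th(1) s by (auto simp: time_changes_def)
      moreover have "t < \<theta> s" "dist (\<theta> s) t < d2"
        using th_s(1) m unfolding s_def dist_real_def by linarith+
      ultimately have "\<bar>y (\<theta> s) - y t\<bar> < e/3" using d2(2) by auto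
      moreover have "\<bar>x s - x t\<bar> < e/3" using d1(2) s by auto
      ultimately show ?thesis using th_s(2) by linarith
    qed
    then have "\<bar>x t - y t\<bar> \<le> 0" by (rule field_le_epsilon) simp
    then show ?thesis by simp
  qed
qed

lemma Metric_space_skorokhod:
  assumes "0 \<le> T"
  shows "Metric_space (skorokhod_space T) (skorokhod_dist T)"
proof
  show nn: "0 \<le> skorokhod_dist T x y" for x y
    using skorokhod_close_ex[of x T y]
    by (auto simp: skorokhod_dist_def intro!: cInf_greatest)
  show "skorokhod_dist T x y = skorokhod_dist T y x" for x y
  proof -
    have "skorokhod_close T x y = skorokhod_close T y x"
      using skorokhod_close_sym by blast
    then show ?thesis by (simp add: skorokhod_dist_def)
  qed
  show "skorokhod_dist T x y = 0 \<longleftrightarrow> x = y"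
    if xy: "x \<in> skorokhod_space T" "y \<in> skorokhod_space T" for x y
  proof
    assume "x = y"
    have "skorokhod_dist T x x \<le> 0 + e" if e: "0 < e" for e
    proof -
      have "skorokhod_close T x x e"
        unfolding skorokhod_close_def using e by (intro bexI[OF _ id_time_change]) auto
      with skorokhod_dist_le xy e show ?thesis by simp
    qed
    then have "skorokhod_dist T x x \<le> 0" by (rule field_le_epsilon)
    with nn \<open>x = y\<close> show "skorokhod_dist T x y = 0" by (simp add: antisym)
  qed (use skorokhod_dist_zeroD[OF assms xy] in auto)
  show "skorokhod_dist T x z \<le> skorokhod_dist T x y + skorokhod_dist T y z"
    if xyz: "x \<in> skorokhod_space T" "y \<in> skorokhod_space T" "z \<in> skorokhod_space T" for x y z
  proof (rule field_le_epsilon)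
    fix e :: real assume e: "0 < e"
    obtain a where a: "0 < a" "a < skorokhod_dist T x y + e/2" "skorokhod_close T x y a"
      by (rule skorokhod_dist_lessD[OF xyz(1,2), of "skorokhod_dist T x y + e/2"]) (use e in auto)
    obtain b where b: "0 < b" "b < skorokhod_dist T y z + e/2" "skorokhod_close T y z b"
      by (rule skorokhod_dist_lessD[OF xyz(2,3), of "skorokhod_dist T y z + e/2"]) (use e in auto)
    have "skorokhod_dist T x z \<le> a + b"
      by (rule skorokhod_dist_le) (use xyz a b skorokhod_close_trans in auto)
    with a b show "skorokhod_dist T x z \<le> skorokhod_dist T x y + skorokhod_dist T y z + e" by simp
  qed
qed


section \<open>Convergence in distribution of processes\<close>

definition weak_convergence_on ::
    "'b topology \<Rightarrow> (nat \<Rightarrow> 'b measure) \<Rightarrow> 'b measure \<Rightarrow> bool" where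
  "weak_convergence_on X N N' \<longleftrightarrow>
     (\<forall>f. continuous_map X euclideanreal f \<and> bounded (f ` topspace X) \<longrightarrow>
        (\<lambda>n. \<integral>x. f x \<partial>N n) \<longlonglongrightarrow> (\<integral>x. f x \<partial>N'))"

definition path_on :: "real \<Rightarrow> (real \<Rightarrow> 'a \<Rightarrow> real) \<Rightarrow> 'a \<Rightarrow> real \<Rightarrow> real" where
  "path_on T X \<omega> = (\<lambda>t\<in>{0..T}. X t \<omega>)"

definition path_law ::
    "real \<Rightarrow> 'a measure \<Rightarrow> (real \<Rightarrow> 'a \<Rightarrow> real) \<Rightarrow> (real \<Rightarrow> real) measure" where
  "path_law T P X = distr P (borel_on (skorokhod_topology T)) (path_on T X)"

text \<open>Convergence in distribution of processes \<open>X 1, X 2, \<dots>\<close>, each on its own probability space, to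
  a deterministic function \<open>z\<close>.  Measurability of the path maps is part of the notion, since
  \<^const>\<open>distr\<close> and the integral take default values on maps that are not measurable.  The
  sequence starts at index 1.\<close>

definition process_conv_in_dist ::
    "(nat \<Rightarrow> 'a measure) \<Rightarrow> (nat \<Rightarrow> real \<Rightarrow> 'a \<Rightarrow> real) \<Rightarrow> (real \<Rightarrow> real) \<Rightarrow> bool" where
  "process_conv_in_dist P X z \<longleftrightarrow>
     (\<forall>T>0.
        (\<forall>n\<ge>1. path_on T (X n) \<in> measurable (P n) (borel_on (skorokhod_topology T))) \<and>
        restrict z {0..T} \<in> skorokhod_space T \<and>
        weak_convergence_on (skorokhod_topology T)
          (\<lambda>n. path_law T (P n) (X n))
          (return (borel_on (skorokhod_topology T)) (restrict z {0..T})))"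


section \<open>Finite-state continuous-time Markov chains\<close>

definition generator :: "'s set \<Rightarrow> ('s \<Rightarrow> 's \<Rightarrow> real) \<Rightarrow> 's \<Rightarrow> 's \<Rightarrow> real" where
  "generator S r i j = (if i = j then - (\<Sum>k\<in>S - {i}. r i k) else r i j)"

definition transition_semigroup :: "'s set \<Rightarrow> (real \<Rightarrow> 's \<Rightarrow> 's \<Rightarrow> real) \<Rightarrow> bool" where
  "transition_semigroup S p \<longleftrightarrow>
     (\<forall>t\<ge>0. \<forall>i\<in>S. (\<forall>j\<in>S. 0 \<le> p t i j) \<and> (\<Sum>j\<in>S. p t i j) = 1) \<and>
     (\<forall>i\<in>S. \<forall>j\<in>S. p 0 i j = (if i = j then 1 else 0)) \<and>
     (\<forall>s\<ge>0. \<forall>t\<ge>0. \<forall>i\<in>S. \<forall>j\<in>S. p (s + t) i j = (\<Sum>k\<in>S. p s i k * p t k j))"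

definition has_rates ::
    "'s set \<Rightarrow> (real \<Rightarrow> 's \<Rightarrow> 's \<Rightarrow> real) \<Rightarrow> ('s \<Rightarrow> 's \<Rightarrow> real) \<Rightarrow> bool" where
  "has_rates S p r \<longleftrightarrow>
     (\<forall>i\<in>S. \<forall>j\<in>S.
        ((\<lambda>t. p t i j) has_real_derivative generator S r i j) (at 0 within {0..}))"

definition markov_with ::
    "'s set \<Rightarrow> (real \<Rightarrow> 's \<Rightarrow> 's \<Rightarrow> real) \<Rightarrow> 'a measure \<Rightarrow> (real \<Rightarrow> 'a \<Rightarrow> 's) \<Rightarrow> bool" where
  "markov_with S p P X \<longleftrightarrow>
     (\<forall>(k::nat) (t :: nat \<Rightarrow> real) i h j.
        0 \<le> t 0 \<and> (\<forall>l<k. t l \<le> t (Suc l)) \<and> 0 \<le> h \<and>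
        0 < \<P>(\<omega> in P. \<forall>l\<le>k. X (t l) \<omega> = i l) \<and> j \<in> S \<longrightarrow>
        \<P>(\<omega> in P. X (t k + h) \<omega> = j \<bar> \<forall>l\<le>k. X (t l) \<omega> = i l) = p h (i k) j)"

text \<open>As \<open>S\<close> is finite, the rates determine the semigroup and no explosion can occur.  The state
  type is meant to carry its discrete topology, as \<^typ>\<open>nat \<times> nat\<close> does, so that cadlag paths
  are piecewise constant.\<close>

definition finite_ctmc ::
    "'s::topological_space set \<Rightarrow> ('s \<Rightarrow> 's \<Rightarrow> real) \<Rightarrow> 'a measure \<Rightarrow> (real \<Rightarrow> 'a \<Rightarrow> 's) \<Rightarrow> bool" where
  "finite_ctmc S r P X \<longleftrightarrow>
     finite S \<and> prob_space P \<and>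
     (\<forall>t\<ge>0. X t \<in> measurable P (count_space S)) \<and>
     (\<forall>\<omega>\<in>space P. cadlag_on {0..} (\<lambda>t. X t \<omega>)) \<and>
     (\<exists>p. transition_semigroup S p \<and> has_rates S p r \<and> markov_with S p P X)"


section \<open>The charging station\<close>

definition station_states :: "nat \<Rightarrow> (nat \<times> nat) set" where
  "station_states K = {(q, z). z \<le> q \<and> q \<le> K}"

fun station_rate ::
    "real \<Rightarrow> nat \<Rightarrow> real \<Rightarrow> real \<Rightarrow> real \<Rightarrow> nat \<times> nat \<Rightarrow> nat \<times> nat \<Rightarrow> real" where
  "station_rate lam K M mu nu (q, z) (q', z') =
     (if q' = q + 1 \<and> z' = z + 1 \<and> q < K then lam
      else if q' = q \<and> z = z' + 1 then mu * min (real z) M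
      else if q = q' + 1 \<and> z = z' + 1 then nu * real z
      else if q = q' + 1 \<and> z' = z then nu * (real q - real z)
      else 0)"

definition charging_station_process ::
    "real \<Rightarrow> nat \<Rightarrow> real \<Rightarrow> real \<Rightarrow> real \<Rightarrow>
     'a measure \<Rightarrow> (real \<Rightarrow> 'a \<Rightarrow> nat) \<Rightarrow> (real \<Rightarrow> 'a \<Rightarrow> nat) \<Rightarrow> bool" where
  "charging_station_process lam K M mu nu P Q Z \<longleftrightarrow>
     finite_ctmc (station_states K) (station_rate lam K M mu nu) P (\<lambda>t \<omega>. (Q t \<omega>, Z t \<omega>)) \<and>
     integrable P (\<lambda>\<omega>. real (Q 0 \<omega>)) \<and> integrable P (\<lambda>\<omega>. real (Z 0 \<omega>))"

end

theory Submission
  imports Defs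
begin

text \<open>
  Let \<open>x = Q / n\<close> be the scaled number of cars and \<open>w = (Q - Z) / n\<close> the scaled number of fully charged cars.
  Blocking at a full station concerns only \<open>x\<close>, and it does so harmlessly.  The fluid limit of \<open>x\<close> is
  the solution \<open>\<xi>\<close> of \<open>\<xi>' = min lam (nu K) - nu \<xi>\<close> with \<open>\<xi> 0 = K\<close>, and the difference between the
  admission rate and \<open>min lam (nu K)\<close> never has the sign that drives \<open>x\<close> away from \<open>\<xi>\<close>.  The drift of \<open>w\<close> is
  \<open>mu min (x - w) M - nu w\<close>, a Lipschitz function of \<open>x\<close> and \<open>w\<close> in which arrivals do not occur.  With \<open>z\<close> the solution of
  the limit equation, \<open>\<xi> - z\<close> satisfies the corresponding equation.  Therefore the squared deviation
  \<open>U = (x - \<xi>)\<^sup>2 + (w - (\<xi> - z))\<^sup>2\<close> has drift at most \<open>3 mu U + C / n\<close>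
  (\<open>station_deviation_drift\<close>), and \<open>exp (- 3 mu t) U + (C / n) (T - t)\<close> is a supersolution of the backward
  equation of the chain.

  A nonnegative supersolution is a supermartingale along the chain.  Doob's maximal inequality for it
  is derived here directly from the finite-dimensional Markov property, on finite grids and
  then, by right continuity of the paths, on \<open>[0, T]\<close> (\<open>ctmc_maximal_inequality\<close>).  It
  bounds the probability that \<open>Z / n\<close> ever leaves a tube around \<open>z\<close> by a constant times the expected initial
  deviation plus \<open>C T / n\<close>.  The initial deviation tends to \<open>0\<close> because the initial values are bounded and
  converge in distribution to constants (\<open>weak_conv_const_imp_second_moment\<close>).

  Uniform convergence in probability gives weak convergence in the Skorokhod space
  (\<open>path_law_converges_to_constant\<close>), once the path maps are known to be measurable for its Borel sets;
  this holds because a path with finitely many jumps is the \<open>J\<^sub>1\<close> limit of its samples on time grids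
  (\<open>path_on_measurable\<close>).  The limit equation itself is solved by an explicit formula on each side
  of the kink of \<open>min\<close> (\<open>fluid_ode_solution\<close>).
\<close>

section \<open>The limit equation\<close>

lemma exponential_relaxation_deriv:
  fixes a b y :: real
  shows "((\<lambda>t. a + (y - a) * exp (- b * t)) has_real_derivative
           b * (a - (a + (y - a) * exp (- b * t)))) (at t within A)"
  by (auto intro!: derivative_eq_intros simp: algebra_simps)

lemma exponential_relaxation_between:
  fixes a b y t :: real
  assumes "0 \<le> b" "0 \<le> t"
  shows "min y a \<le> a + (y - a) * exp (- b * t)" "a + (y - a) * exp (- b * t) \<le> max y a"
proof -
  define s where "s = exp (- b * t)"
  have s: "0 \<le> s" "s \<le> 1" using assms by (auto simp: s_def)
  have eq: "a + (y - a) * s = (1 - s) * a + s * y" by (simp add: algebra_simps)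
  have "(1 - s) * min y a + s * min y a \<le> (1 - s) * a + s * y"
    using s by (intro add_mono mult_left_mono) auto
  then show "min y a \<le> a + (y - a) * exp (- b * t)"
    unfolding s_def[symmetric] eq by (simp add: algebra_simps)
  have "(1 - s) * a + s * y \<le> (1 - s) * max y a + s * max y a"
    using s by (intro add_mono mult_left_mono) auto
  then show "a + (y - a) * exp (- b * t) \<le> max y a"
    unfolding s_def[symmetric] eq by (simp add: algebra_simps)
qed

text \<open>The hitting time is explicit because the distance to the equilibrium \<open>a\<close> decays by a known factor.
Both orientations are needed: the level may be approached from above or from below.\<close>

lemma exponential_relaxation_hits:
  fixes a b y m :: real
  assumes b: "0 < b" and m: "a < m \<and> m \<le> y \<or> y \<le> m \<and> m < a"
  obtains \<tau> where "0 \<le> \<tau>" "a + (y - a) * exp (- b * \<tau>) = m"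
    "\<And>t. 0 \<le> t \<Longrightarrow> t \<le> \<tau> \<Longrightarrow> min y m \<le> a + (y - a) * exp (- b * t)"
    "\<And>t. 0 \<le> t \<Longrightarrow> t \<le> \<tau> \<Longrightarrow> a + (y - a) * exp (- b * t) \<le> max y m"
proof -
  define \<tau> where "\<tau> = ln ((y - a) / (m - a)) / b"
  have ge: "1 \<le> (y - a) / (m - a)" using m by (auto simp: le_divide_eq)
  have \<tau>: "0 \<le> \<tau>" using ge b by (simp add: \<tau>_def)
  have "exp (- b * \<tau>) = inverse ((y - a) / (m - a))"
    using b ge by (simp add: \<tau>_def exp_minus)
  then have hit: "a + (y - a) * exp (- b * \<tau>) = m"
    using m by (auto simp: field_simps)
  have "min y m \<le> a + (y - a) * exp (- b * t) \<and> a + (y - a) * exp (- b * t) \<le> max y m"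
    if t: "0 \<le> t" "t \<le> \<tau>" for t
  proof -
    have e: "exp (- b * \<tau>) \<le> exp (- b * t)" "exp (- b * t) \<le> 1" using t b by auto
    show ?thesis
    proof (cases "a < m")
      case True
      then have "0 \<le> y - a" "m \<le> y" using m by auto
      with mult_left_mono[OF e(1), of "y - a"] mult_left_mono[OF e(2), of "y - a"] hit
      show ?thesis by auto
    next
      case False
      then have "y - a \<le> 0" "y \<le> m" using m by auto
      with mult_left_mono_neg[OF e(1), of "y - a"] mult_left_mono_neg[OF e(2), of "y - a"] hit
      show ?thesis by auto
    qed
  qed
  with \<tau> hit that show ?thesis by blast
qed

text \<open>The right-hand side does not depend on time, so the derivatives from the left and from the right at
the junction are both \<open>F\<close> of the common value.\<close>

lemma autonomous_ode_concat:
  fixes F f g :: "real \<Rightarrow> real"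
  assumes \<tau>: "0 \<le> \<tau>" and joint: "f \<tau> = g 0"
    and f: "\<And>t. 0 \<le> t \<Longrightarrow> t \<le> \<tau> \<Longrightarrow> (f has_real_derivative F (f t)) (at t)"
    and g: "\<And>t. 0 \<le> t \<Longrightarrow> (g has_real_derivative F (g t)) (at t)"
    and t: "0 \<le> t"
  shows "((\<lambda>t. if t \<le> \<tau> then f t else g (t - \<tau>)) has_real_derivative
           F (if t \<le> \<tau> then f t else g (t - \<tau>))) (at t)"
    (is "(?z has_real_derivative _) _")
proof -
  have shifted: "((\<lambda>t. g (t - \<tau>)) has_real_derivative F (g (t - \<tau>))) (at t)" if "\<tau> \<le> t" for t
    using DERIV_shift[of g "F (g (t - \<tau>))" t "- \<tau>"] g[of "t - \<tau>"] that by simp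
  consider "t < \<tau>" | "t = \<tau>" | "\<tau> < t" by linarith
  then show ?thesis
  proof cases
    case 1
    have "(?z has_real_derivative F (f t)) (at t)"
      by (rule has_field_derivative_transform_within_open[OF f, of _ "{..<\<tau>}"]) (use 1 t in auto)
    with 1 show ?thesis by simp
  next
    case 3
    have "(?z has_real_derivative F (g (t - \<tau>))) (at t)"
      by (rule has_field_derivative_transform_within_open[OF shifted, of _ "{\<tau><..}"]) (use 3 in auto)
    with 3 show ?thesis by simp
  next
    case 2
    have l: "(?z has_real_derivative F (f t)) (at t within {..t})"
      by (rule has_field_derivative_transform_within[OF has_field_derivative_at_within[OF f], of _ 1])
        (use 2 t in auto)
    have "((\<lambda>s. g (s - \<tau>)) has_real_derivative F (f t)) (at t within {t..})"
      using has_field_derivative_at_within[OF shifted[of t]] 2 joint by simp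
    then have r: "(?z has_real_derivative F (f t)) (at t within {t..})"
      by (rule has_field_derivative_transform_within[of _ _ _ _ 1]) (use 2 joint in auto)
    have "(?z has_real_derivative F (f t)) (at t within {..t} \<union> {t..})"
      using l r unfolding has_field_derivative_iff Lim_within_Un by blast
    moreover have "{..t} \<union> {t..} = UNIV" by auto
    ultimately show ?thesis using 2 by simp
  qed
qed

text \<open>The right-hand side is affine on either side of the kink at \<open>M\<close>, so on each side the solution is an
exponential relaxation (\<open>lo\<close> below the kink, \<open>up\<close> above it).  The kink is crossed at most once: after
the crossing, the new branch relaxes to an equilibrium beyond \<open>M\<close>.  The two formulas are therefore
joined at most once, at the time at which the first one reaches \<open>M\<close>.\<close>

lemma fluid_ode_solution:
  fixes c mu nu M K z0 :: real
  assumes mu: "0 < mu" and nu: "0 < nu" and M: "0 < M" "M \<le> K"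
    and c: "0 \<le> c" "c \<le> nu * K" and z0: "0 \<le> z0" "z0 \<le> K"
  obtains z where "z 0 = z0" "\<And>t. 0 \<le> t \<Longrightarrow> 0 \<le> z t" "\<And>t. 0 \<le> t \<Longrightarrow> z t \<le> K"
    "\<And>t. 0 \<le> t \<Longrightarrow> (z has_real_derivative (c - nu * z t - mu * min (z t) M)) (at t)"
proof -
  define F where "F y = c - nu * y - mu * min y M" for y
  define lo where "lo y t = c / (nu + mu) + (y - c / (nu + mu)) * exp (- (nu + mu) * t)" for y t
  define up where "up y t = (c - mu * M) / nu + (y - (c - mu * M) / nu) * exp (- nu * t)" for y t
  have lo0: "lo y 0 = y" and up0: "up y 0 = y" for y by (simp_all add: lo_def up_def)
  have b_lo: "0 \<le> c / (nu + mu)" "c / (nu + mu) \<le> K"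
  proof -
    show "0 \<le> c / (nu + mu)" using mu nu c by simp
    have "0 \<le> mu * K" using mu M by simp
    with c have "c \<le> K * (nu + mu)" by (simp add: algebra_simps)
    then show "c / (nu + mu) \<le> K" using mu nu by (simp add: divide_le_eq)
  qed
  have b_up: "(c - mu * M) / nu \<le> K"
  proof -
    have "0 \<le> mu * M" using mu M by simp
    with c have "c - mu * M \<le> K * nu" by (simp add: algebra_simps)
    then show ?thesis using nu by (simp add: divide_le_eq)
  qed
  \<comment> \<open>With both equilibria on the same side of the kink, the branch that takes over there moves away from it.\<close>
  have side: "c / (nu + mu) < M \<longleftrightarrow> (c - mu * M) / nu < M"
             "M < c / (nu + mu) \<longleftrightarrow> M < (c - mu * M) / nu"
    using mu nu by (auto simp: field_simps)
  have lo: "(lo y has_real_derivative F (lo y t)) (at t)" if "lo y t \<le> M" for y t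
  proof -
    have "F (lo y t) = (nu + mu) * (c / (nu + mu) - lo y t)"
      using that mu nu by (simp add: F_def min_def field_simps)
    then show ?thesis
      using exponential_relaxation_deriv[of "c / (nu + mu)" y "nu + mu" t UNIV]
      unfolding lo_def[abs_def] by simp
  qed
  have up: "(up y has_real_derivative F (up y t)) (at t)" if "M \<le> up y t" for y t
  proof -
    have "F (up y t) = nu * ((c - mu * M) / nu - up y t)"
      using that mu nu by (simp add: F_def min_def field_simps)
    then show ?thesis
      using exponential_relaxation_deriv[of "(c - mu * M) / nu" y nu t UNIV]
      unfolding up_def[abs_def] by simp
  qed
  have lo_btw: "min y (c / (nu + mu)) \<le> lo y t" "lo y t \<le> max y (c / (nu + mu))" if "0 \<le> t" for y t
    unfolding lo_def by (rule exponential_relaxation_between; use that mu nu in simp)+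
  have up_btw: "min y ((c - mu * M) / nu) \<le> up y t" "up y t \<le> max y ((c - mu * M) / nu)"
    if "0 \<le> t" for y t
    unfolding up_def by (rule exponential_relaxation_between; use that nu in simp)+
  have "\<exists>z. z 0 = z0 \<and> (\<forall>t\<ge>0. 0 \<le> z t \<and> z t \<le> K \<and> (z has_real_derivative F (z t)) (at t))"
  proof (cases "M \<le> z0")
    case above: True
    show ?thesis
    proof (cases "M \<le> (c - mu * M) / nu")
      case True
      have b: "M \<le> up z0 t" "0 \<le> up z0 t" "up z0 t \<le> K" if "0 \<le> t" for t
        using up_btw[OF that, of z0] above True z0 b_up M by auto
      show ?thesis by (intro exI[of _ "up z0"] conjI allI impI up0 b up)
    next
      case False
      obtain \<tau> where \<tau>: "0 \<le> \<tau>" "up z0 \<tau> = M"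
        "\<And>t. 0 \<le> t \<Longrightarrow> t \<le> \<tau> \<Longrightarrow> min z0 M \<le> up z0 t"
        "\<And>t. 0 \<le> t \<Longrightarrow> t \<le> \<tau> \<Longrightarrow> up z0 t \<le> max z0 M"
        unfolding up_def
        by (rule exponential_relaxation_hits[of nu "(c - mu * M) / nu" M z0, OF nu])
          (use above False in auto)
      let ?z = "\<lambda>t. if t \<le> \<tau> then up z0 t else lo M (t - \<tau>)"
      have after: "lo M t \<le> M" "0 \<le> lo M t" "lo M t \<le> K" if "0 \<le> t" for t
        using lo_btw[OF that, of M] False side M b_lo by auto
      have before: "M \<le> up z0 t" "0 \<le> up z0 t" "up z0 t \<le> K" if "0 \<le> t" "t \<le> \<tau>" for t
        using \<tau>(3,4)[OF that] above M z0 by auto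
      have "(?z has_real_derivative F (?z t)) (at t)" if "0 \<le> t" for t
        proof (rule autonomous_ode_concat[where f = "up z0" and g = "lo M" and F = F, OF \<tau>(1) _ _ _ that])
        show "up z0 \<tau> = lo M 0" using \<tau>(2) lo0 by simp
      qed (rule up[OF before(1)], assumption, assumption, rule lo[OF after(1)], assumption)
      moreover have "0 \<le> ?z t \<and> ?z t \<le> K" if "0 \<le> t" for t
        using before[of t] after[of "t - \<tau>"] that by simp
      moreover have "?z 0 = z0" using \<tau>(1) up0 by simp
      ultimately have "?z 0 = z0 \<and> (\<forall>t\<ge>0. 0 \<le> ?z t \<and> ?z t \<le> K \<and> (?z has_real_derivative F (?z t)) (at t))"
        by simp
      then show ?thesis by (rule exI[of _ ?z])
    qed
  next
    case below: False
    show ?thesis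
    proof (cases "c / (nu + mu) \<le> M")
      case True
      have b: "lo z0 t \<le> M" "0 \<le> lo z0 t" "lo z0 t \<le> K" if "0 \<le> t" for t
        using lo_btw[OF that, of z0] below True z0 b_lo M by auto
      show ?thesis by (intro exI[of _ "lo z0"] conjI allI impI lo0 b lo)
    next
      case False
      obtain \<tau> where \<tau>: "0 \<le> \<tau>" "lo z0 \<tau> = M"
        "\<And>t. 0 \<le> t \<Longrightarrow> t \<le> \<tau> \<Longrightarrow> min z0 M \<le> lo z0 t"
        "\<And>t. 0 \<le> t \<Longrightarrow> t \<le> \<tau> \<Longrightarrow> lo z0 t \<le> max z0 M"
        unfolding lo_def
        by (rule exponential_relaxation_hits[of "nu + mu" "c / (nu + mu)" M z0, OF add_pos_pos[OF nu mu]])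
          (use below False in auto)
      let ?z = "\<lambda>t. if t \<le> \<tau> then lo z0 t else up M (t - \<tau>)"
      have after: "M \<le> up M t" "0 \<le> up M t" "up M t \<le> K" if "0 \<le> t" for t
        using up_btw[OF that, of M] False side M b_up by auto
      have before: "lo z0 t \<le> M" "0 \<le> lo z0 t" "lo z0 t \<le> K" if "0 \<le> t" "t \<le> \<tau>" for t
        using \<tau>(3,4)[OF that] below M z0 by auto
      have "(?z has_real_derivative F (?z t)) (at t)" if "0 \<le> t" for t
        proof (rule autonomous_ode_concat[where f = "lo z0" and g = "up M" and F = F, OF \<tau>(1) _ _ _ that])
        show "lo z0 \<tau> = up M 0" using \<tau>(2) up0 by simp
      qed (rule lo[OF before(1)], assumption, assumption, rule up[OF after(1)], assumption)
      moreover have "0 \<le> ?z t \<and> ?z t \<le> K" if "0 \<le> t" for t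
        using before[of t] after[of "t - \<tau>"] that by simp
      moreover have "?z 0 = z0" using \<tau>(1) lo0 by simp
      ultimately have "?z 0 = z0 \<and> (\<forall>t\<ge>0. 0 \<le> ?z t \<and> ?z t \<le> K \<and> (?z has_real_derivative F (?z t)) (at t))"
        by simp
      then show ?thesis by (rule exI[of _ ?z])
    qed
  qed
  then show ?thesis using that unfolding F_def by blast
qed

section \<open>Supermartingales of finite Markov chains\<close>

lemma transition_semigroup_le_1:
  assumes "transition_semigroup S p" "finite S" "0 \<le> t" "i \<in> S" "j \<in> S"
  shows "p t i j \<le> 1"
proof -
  have "p t i j \<le> (\<Sum>j\<in>S. p t i j)"
    using assms by (intro member_le_sum) (auto simp: transition_semigroup_def)
  then show ?thesis using assms by (auto simp: transition_semigroup_def)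
qed

text \<open>Writing \<open>p u = p (u - t) \<circ> p t\<close>, the difference \<open>p t - p u\<close> is controlled by \<open>p (u - t) - p 0\<close>, which tends to
\<open>0\<close> because the rates are derivatives at time \<open>0\<close>.\<close>

lemma transition_semigroup_left_continuous:
  assumes S: "finite S" and p: "transition_semigroup S p" and r: "has_rates S p r"
    and i: "i \<in> S" and j: "j \<in> S" and u: "0 \<le> u"
  shows "((\<lambda>t. p t i j) \<longlongrightarrow> p u i j) (at u within {0..u})"
proof -
  have p0: "p 0 i k = (if i = k then 1 else 0)" if "k \<in> S" for k
    using p i that by (simp add: transition_semigroup_def)
  have rev: "filterlim (\<lambda>t. u - t) (at 0 within {0..}) (at u within {0..u})"
    unfolding filterlim_at
    by (auto intro!: tendsto_eq_intros simp: eventually_at_filter)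
  have cont: "((\<lambda>h. p h i k) \<longlongrightarrow> p 0 i k) (at 0 within {0..})" if "k \<in> S" for k
    using DERIV_continuous[of "\<lambda>h. p h i k"] r i that
    unfolding has_rates_def continuous_within by blast
  have "((\<lambda>t. \<Sum>k\<in>S. \<bar>p (u - t) i k - p 0 i k\<bar>) \<longlongrightarrow> (\<Sum>k\<in>S. \<bar>p 0 i k - p 0 i k\<bar>))
          (at u within {0..u})"
    by (intro tendsto_intros filterlim_compose[OF cont rev])
  then have lim: "((\<lambda>t. \<Sum>k\<in>S. \<bar>p (u - t) i k - p 0 i k\<bar>) \<longlongrightarrow> 0) (at u within {0..u})" by simp
  have "\<bar>p t i j - p u i j\<bar> \<le> (\<Sum>k\<in>S. \<bar>p (u - t) i k - p 0 i k\<bar>)" if t: "t \<in> {0..u}" for t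
  proof -
    have "p ((u - t) + t) i j = (\<Sum>k\<in>S. p (u - t) i k * p t k j)"
      using p t i j unfolding transition_semigroup_def by (meson atLeastAtMost_iff diff_ge_0_iff_ge)
    moreover have "p t i j = (\<Sum>k\<in>S. p 0 i k * p t k j)"
      using S i by (simp add: p0 if_distrib[of "\<lambda>c. c * _"] sum.delta cong: if_cong)
    ultimately have "p t i j - p u i j = - (\<Sum>k\<in>S. (p (u - t) i k - p 0 i k) * p t k j)"
      by (simp add: sum_subtractf left_diff_distrib)
    then have "\<bar>p t i j - p u i j\<bar> \<le> (\<Sum>k\<in>S. \<bar>(p (u - t) i k - p 0 i k) * p t k j\<bar>)"
      by (simp add: sum_abs)
    also have "\<dots> \<le> (\<Sum>k\<in>S. \<bar>p (u - t) i k - p 0 i k\<bar>)"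
    proof (rule sum_mono)
      fix k assume k: "k \<in> S"
      have "0 \<le> p t k j" "p t k j \<le> 1"
        using p t k j transition_semigroup_le_1[OF p S] by (auto simp: transition_semigroup_def)
      then show "\<bar>(p (u - t) i k - p 0 i k) * p t k j\<bar> \<le> \<bar>p (u - t) i k - p 0 i k\<bar>"
        by (simp add: abs_mult mult_left_le)
    qed
    finally show ?thesis .
  qed
  then have "((\<lambda>t. p t i j - p u i j) \<longlongrightarrow> 0) (at u within {0..u})"
    by (intro Lim_null_comparison[OF _ lim]) (auto simp: eventually_at_filter)
  then show ?thesis using LIM_zero_iff by blast
qed

text \<open>On the right of \<open>u\<close> this is the definition of the rates applied to \<open>p (u + h) = p u \<circ> p h\<close>.  On the left, the
increment is taken from \<open>t < u\<close>, so the factor in front is \<open>p t\<close> and not \<open>p u\<close>; left continuity removes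
the difference.\<close>

lemma kolmogorov_forward:
  assumes S: "finite S" and p: "transition_semigroup S p" and r: "has_rates S p r"
    and i: "i \<in> S" and j: "j \<in> S" and u: "0 \<le> u"
  shows "((\<lambda>t. p t i j) has_real_derivative (\<Sum>k\<in>S. p u i k * generator S r k j)) (at u within {0..})"
proof -
  have ck: "p (s + t) i j = (\<Sum>k\<in>S. p s i k * p t k j)" if "0 \<le> s" "0 \<le> t" for s t
    using p i j that unfolding transition_semigroup_def by blast
  have p0: "p 0 k j = (if k = j then 1 else 0)" if "k \<in> S" for k
    using p j that by (simp add: transition_semigroup_def)
  have d0: "((\<lambda>h. p h k j) has_real_derivative generator S r k j) (at 0 within {0..})" if "k \<in> S" for k
    using r j that by (simp add: has_rates_def)
  let ?D = "\<Sum>k\<in>S. p u i k * generator S r k j"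
  have right: "((\<lambda>t. p t i j) has_real_derivative ?D) (at u within {u..})"
  proof -
    have img: "(\<lambda>t. t - u) ` {u..} = {0..}"
      by (auto simp: image_iff intro!: bexI[of _ "_ + u"])
    have "((\<lambda>h. \<Sum>k\<in>S. p u i k * p h k j) has_real_derivative ?D) (at 0 within {0..})"
      by (intro DERIV_sum DERIV_cmult d0)
    then have "((\<lambda>h. \<Sum>k\<in>S. p u i k * p h k j) \<circ> (\<lambda>t. t - u) has_real_derivative ?D * 1) (at u within {u..})"
      by (intro DERIV_image_chain) (auto simp: img intro!: derivative_eq_intros)
    then have "((\<lambda>t. \<Sum>k\<in>S. p u i k * p (t - u) k j) has_real_derivative ?D) (at u within {u..})"
      by (simp add: o_def)
    then show ?thesis
    proof (rule has_field_derivative_transform_within[of _ _ _ _ 1])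
      fix t assume "t \<in> {u..}"
      then show "(\<Sum>k\<in>S. p u i k * p (t - u) k j) = p t i j"
        using ck[of u "t - u"] u by simp
    qed (use u in auto)
  qed
  have left: "((\<lambda>t. p t i j) has_real_derivative ?D) (at u within {0..u})"
    unfolding has_field_derivative_iff
  proof (rule Lim_transform_eventually)
    have rev: "filterlim (\<lambda>t. u - t) (at 0 within {0..}) (at u within {0..u})"
      unfolding filterlim_at
      by (auto intro!: tendsto_eq_intros simp: eventually_at_filter)
    have "((\<lambda>h. (p h k j - p 0 k j) / (h - 0)) \<longlongrightarrow> generator S r k j) (at 0 within {0..})"
      if "k \<in> S" for k
      using d0[OF that] by (simp add: has_field_derivative_iff)
    then show "((\<lambda>t. \<Sum>k\<in>S. p t i k * ((p (u - t) k j - p 0 k j) / ((u - t) - 0))) \<longlongrightarrow> ?D)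
            (at u within {0..u})"
      by (intro tendsto_sum tendsto_mult filterlim_compose[OF _ rev]
          transition_semigroup_left_continuous[OF S p r i _ u])
    have "(\<Sum>k\<in>S. p t i k * ((p (u - t) k j - p 0 k j) / ((u - t) - 0))) = (p t i j - p u i j) / (t - u)"
      if t: "0 \<le> t" "t < u" for t
    proof -
      have "(\<Sum>k\<in>S. p t i k * p 0 k j) = p t i j"
        using S j by (simp add: p0 if_distrib[of "\<lambda>c. _ * c"] sum.delta cong: if_cong)
      moreover have "(\<Sum>k\<in>S. p t i k * p (u - t) k j) = p u i j"
        using ck[of t "u - t"] t by simp
      ultimately have "(\<Sum>k\<in>S. p t i k * (p (u - t) k j - p 0 k j)) = p u i j - p t i j"
        by (simp add: right_diff_distrib sum_subtractf)
      then have "(\<Sum>k\<in>S. p t i k * ((p (u - t) k j - p 0 k j) / ((u - t) - 0))) = (p u i j - p t i j) / (u - t)"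
        by (simp flip: sum_divide_distrib)
      also have "\<dots> = (p t i j - p u i j) / (t - u)"
        by (metis minus_diff_eq minus_divide_divide)
      finally show ?thesis .
    qed
    then show "eventually (\<lambda>t. (\<Sum>k\<in>S. p t i k * ((p (u - t) k j - p 0 k j) / ((u - t) - 0)))
        = (p t i j - p u i j) / (t - u)) (at u within {0..u})"
      by (auto simp: eventually_at_filter)
  qed
  have "((\<lambda>t. p t i j) has_real_derivative ?D) (at u within {0..u} \<union> {u..})"
    using left right unfolding has_field_derivative_iff Lim_within_Un by blast
  moreover have "{0..u} \<union> {u..} = {0..}" using u by auto
  ultimately show ?thesis by simp
qed

text \<open>A function with \<open>\<partial>\<^sub>t V + G V \<le> 0\<close> decreases in expectation along the chain: by the forward equation, the
derivative of \<open>u \<mapsto> p u (V (s + u))\<close> is the average of \<open>\<partial>\<^sub>t V + G V\<close> under \<open>p u\<close>.\<close>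

lemma semigroup_supersolution:
  assumes S: "finite S" and p: "transition_semigroup S p" and r: "has_rates S p r"
    and V: "\<And>t j. 0 \<le> t \<Longrightarrow> t \<le> T \<Longrightarrow> j \<in> S \<Longrightarrow> ((\<lambda>t. V t j) has_real_derivative V' t j) (at t)"
    and super: "\<And>t i. 0 \<le> t \<Longrightarrow> t \<le> T \<Longrightarrow> i \<in> S \<Longrightarrow>
                  V' t i + (\<Sum>j\<in>S. generator S r i j * V t j) \<le> 0"
    and s: "0 \<le> s" and h: "0 \<le> h" "s + h \<le> T" and i: "i \<in> S"
  shows "(\<Sum>j\<in>S. p h i j * V (s + h) j) \<le> V s i"
proof -
  define D where "D u = (\<Sum>j\<in>S. (\<Sum>k\<in>S. p u i k * generator S r k j) * V (s + u) j + V' (s + u) j * p u i j)" for u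
  have deriv: "((\<lambda>u. \<Sum>j\<in>S. p u i j * V (s + u) j) has_real_derivative D u) (at u within {0..})"
    if u: "0 \<le> u" "u \<le> h" for u
    unfolding D_def
  proof (intro DERIV_sum DERIV_mult kolmogorov_forward[OF S p r i])
    fix j assume j: "j \<in> S"
    have "((\<lambda>t. V t j) has_real_derivative V' (s + u) j) (at (u + s))"
      using V[of "s + u" j] u s h j by (simp add: add.commute)
    then have "((\<lambda>u. V (u + s) j) has_real_derivative V' (s + u) j) (at u)"
      by (simp add: DERIV_shift)
    then show "((\<lambda>u. V (s + u) j) has_real_derivative V' (s + u) j) (at u within {0..})"
      by (simp add: add.commute has_field_derivative_at_within)
  qed (use u in auto)
  have D: "D u \<le> 0" if u: "0 \<le> u" "u \<le> h" for u
  proof -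
    have "(\<Sum>j\<in>S. (\<Sum>k\<in>S. p u i k * generator S r k j) * V (s + u) j)
        = (\<Sum>k\<in>S. p u i k * (\<Sum>j\<in>S. generator S r k j * V (s + u) j))"
      by (simp add: sum_distrib_right sum_distrib_left mult.assoc) (rule sum.swap)
    then have "D u = (\<Sum>k\<in>S. p u i k * (V' (s + u) k + (\<Sum>j\<in>S. generator S r k j * V (s + u) j)))"
      by (simp add: D_def sum.distrib distrib_left mult.commute)
    also have "\<dots> \<le> 0"
      using p i u s h by (intro sum_nonpos mult_nonneg_nonpos super) (auto simp: transition_semigroup_def)
    finally show ?thesis .
  qed
  have "(\<Sum>j\<in>S. p h i j * V (s + h) j) \<le> (\<Sum>j\<in>S. p 0 i j * V (s + 0) j)"
  proof (rule DERIV_nonpos_imp_decreasing_open[OF h(1)])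
    fix u assume u: "0 < u" "u < h"
    then have "at u within {0..} = at u" by (intro at_within_interior) simp
    with deriv[of u] D[of u] u
    show "\<exists>y. ((\<lambda>u. \<Sum>j\<in>S. p u i j * V (s + u) j) has_real_derivative y) (at u) \<and> y \<le> 0" by auto
  next
    show "continuous_on {0..h} (\<lambda>u. \<Sum>j\<in>S. p u i j * V (s + u) j)"
      by (rule DERIV_continuous_on[of _ _ D]) (auto intro!: DERIV_subset[OF deriv])
  qed
  also have "\<dots> = V s i"
    using p i S by (simp add: transition_semigroup_def if_distrib[of "\<lambda>c. c * _"] sum.delta cong: if_cong)
  finally show ?thesis .
qed

lemma measurable_finite_history:
  assumes S: "finite S" and I: "finite I"
    and X: "\<And>l. l \<in> I \<Longrightarrow> X l \<in> measurable P (count_space S)"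
  shows "(\<lambda>\<omega>. \<lambda>l\<in>I. X l \<omega>) \<in> measurable P (count_space (PiE I (\<lambda>_. S)))"
proof (subst measurable_count_space_eq2[OF finite_PiE[OF I S]], intro conjI ballI)
  show "(\<lambda>\<omega>. \<lambda>l\<in>I. X l \<omega>) \<in> space P \<rightarrow> PiE I (\<lambda>_. S)"
    using measurable_space[OF X] by auto
  fix i assume i: "i \<in> PiE I (\<lambda>_. S)"
  have "(\<lambda>\<omega>. \<lambda>l\<in>I. X l \<omega>) -` {i} \<inter> space P = {\<omega>\<in>space P. \<forall>l\<in>I. X l \<omega> = i l}"
    using i by (auto simp: fun_eq_iff PiE_def extensional_def restrict_def)
  also have "\<dots> \<in> sets P"
  proof (rule sets.sets_Collect_finite_All[OF _ I])
    fix l assume l: "l \<in> I"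
    have "{\<omega>\<in>space P. X l \<omega> = i l} = X l -` {i l} \<inter> space P" by auto
    also have "\<dots> \<in> sets P"
      using measurable_sets[OF X[OF l], of "{i l}"] i l by auto
    finally show "{\<omega>\<in>space P. X l \<omega> = i l} \<in> sets P" .
  qed
  finally show "(\<lambda>\<omega>. \<lambda>l\<in>I. X l \<omega>) -` {i} \<inter> space P \<in> sets P" .
qed

lemma (in finite_measure) integrable_finite_valued:
  fixes g :: "'b \<Rightarrow> real"
  assumes "finite A" and H: "H \<in> measurable M (count_space A)"
  shows "integrable M (\<lambda>\<omega>. g (H \<omega>))"
proof (rule integrable_const_bound[where B = "\<Sum>a\<in>A. \<bar>g a\<bar>"])
  show "(\<lambda>\<omega>. g (H \<omega>)) \<in> borel_measurable M"
    by (rule measurable_compose[OF H]) simp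
  show "AE \<omega> in M. norm (g (H \<omega>)) \<le> (\<Sum>a\<in>A. \<bar>g a\<bar>)"
  proof (rule AE_I2)
    fix \<omega> assume "\<omega> \<in> space M"
    then have "H \<omega> \<in> A" using H by (auto simp: measurable_def)
    then show "norm (g (H \<omega>)) \<le> (\<Sum>a\<in>A. \<bar>g a\<bar>)"
      using assms by (auto intro: member_le_sum)
  qed
qed

text \<open>The Markov property as it is stated conditions on a single history of positive probability.  Summation
over the finitely many histories in \<open>B\<close> turns it into a statement about expectations, in which the
histories of probability \<open>0\<close> do not contribute.\<close>

lemma markov_one_step:
  fixes g :: "'s \<Rightarrow> real" and t :: "nat \<Rightarrow> real"
  assumes S: "finite S" and P: "prob_space P"
    and X: "\<And>t. 0 \<le> t \<Longrightarrow> X t \<in> measurable P (count_space S)"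
    and markov: "markov_with S p P X"
    and t: "\<And>l. 0 \<le> t l" "\<And>l. l < k \<Longrightarrow> t l \<le> t (Suc l)" and h: "0 \<le> h"
  shows "(\<integral>\<omega>. (if (\<lambda>l\<in>{..k}. X (t l) \<omega>) \<in> B then g (X (t k + h) \<omega>) else 0) \<partial>P)
       = (\<integral>\<omega>. (if (\<lambda>l\<in>{..k}. X (t l) \<omega>) \<in> B then (\<Sum>j\<in>S. p h (X (t k) \<omega>) j * g j) else 0) \<partial>P)"
proof -
  interpret prob_space P by fact
  let ?\<Pi> = "PiE {..k} (\<lambda>_. S)"
  define H where "H \<omega> = (\<lambda>l\<in>{..k}. X (t l) \<omega>)" for \<omega>
  have H: "H \<in> measurable P (count_space ?\<Pi>)"
    unfolding H_def[abs_def] using t by (intro measurable_finite_history S X) auto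
  have fin: "finite ?\<Pi>" using S by (intro finite_PiE) auto
  define E where "E i = {\<omega>\<in>space P. H \<omega> = i}" for i
  have E: "E i \<in> sets P" if "i \<in> ?\<Pi>" for i
    using measurable_sets[OF H, of "{i}"] that by (simp add: E_def vimage_def Int_def conj_commute)
  have E': "E i = {\<omega>\<in>space P. \<forall>l\<le>k. X (t l) \<omega> = i l}" if "i \<in> ?\<Pi>" for i
    using that by (auto simp: E_def H_def fun_eq_iff PiE_def extensional_def restrict_def)
  define J where "J j = {\<omega>\<in>space P. X (t k + h) \<omega> = j}" for j
  have J: "J j \<in> sets P" if "j \<in> S" for j
    using measurable_sets[OF X, of "t k + h" "{j}"] that t h
    by (simp add: J_def vimage_def Int_def conj_commute)
  have EJ: "measure P (E i \<inter> J j) = measure P (E i) * p h (i k) j" if i: "i \<in> ?\<Pi>" and j: "j \<in> S" for i j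
  proof (cases "measure P (E i) = 0")
    case True
    then have "measure P (E i \<inter> J j) \<le> 0"
      using finite_measure_mono[of "E i \<inter> J j" "E i"] E[OF i] by auto
    then show ?thesis using True by (simp add: measure_le_0_iff)
  next
    case False
    then have pos: "0 < measure P {\<omega>\<in>space P. \<forall>l\<le>k. X (t l) \<omega> = i l}"
      using E'[OF i] by (simp add: zero_less_measure_iff)
    have "cond_prob P (\<lambda>\<omega>. X (t k + h) \<omega> = j) (\<lambda>\<omega>. \<forall>l\<le>k. X (t l) \<omega> = i l) = p h (i k) j"
      using markov t h pos j unfolding markov_with_def by blast
    moreover have "{\<omega>\<in>space P. X (t k + h) \<omega> = j \<and> (\<forall>l\<le>k. X (t l) \<omega> = i l)} = E i \<inter> J j"
      using E'[OF i] by (auto simp: J_def)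
    ultimately show ?thesis using False E'[OF i] by (simp add: cond_prob_def divide_eq_eq mult.commute)
  qed
  have lhs: "(if H \<omega> \<in> B then g (X (t k + h) \<omega>) else 0)
      = (\<Sum>i\<in>?\<Pi> \<inter> B. \<Sum>j\<in>S. g j * indicator (E i \<inter> J j) \<omega>)" if \<omega>: "\<omega> \<in> space P" for \<omega>
  proof -
    have S': "X (t k + h) \<omega> \<in> S" using X[of "t k + h"] t h \<omega> by (auto simp: measurable_def)
    have \<Pi>: "H \<omega> \<in> ?\<Pi>" using H \<omega> by (auto simp: measurable_def)
    have "(\<Sum>i\<in>?\<Pi> \<inter> B. \<Sum>j\<in>S. g j * indicator (E i \<inter> J j) \<omega>)
        = (\<Sum>i\<in>?\<Pi> \<inter> B. if i = H \<omega> then (\<Sum>j\<in>S. if j = X (t k + h) \<omega> then g j else 0) else 0)"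
      using \<omega> by (intro sum.cong refl) (auto simp: E_def J_def indicator_def intro!: sum.cong sum.neutral)
    also have "\<dots> = (if H \<omega> \<in> B then g (X (t k + h) \<omega>) else 0)"
      using S fin S' \<Pi> by (simp add: sum.delta')
    finally show ?thesis ..
  qed
  have rhs: "(if H \<omega> \<in> B then (\<Sum>j\<in>S. p h (X (t k) \<omega>) j * g j) else 0)
      = (\<Sum>i\<in>?\<Pi> \<inter> B. (\<Sum>j\<in>S. p h (i k) j * g j) * indicator (E i) \<omega>)" if \<omega>: "\<omega> \<in> space P" for \<omega>
  proof -
    have \<Pi>: "H \<omega> \<in> ?\<Pi>" using H \<omega> by (auto simp: measurable_def)
    have "(\<Sum>i\<in>?\<Pi> \<inter> B. (\<Sum>j\<in>S. p h (i k) j * g j) * indicator (E i) \<omega>)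
        = (\<Sum>i\<in>?\<Pi> \<inter> B. if i = H \<omega> then (\<Sum>j\<in>S. p h (H \<omega> k) j * g j) else 0)"
      using \<omega> by (intro sum.cong refl) (auto simp: E_def indicator_def)
    also have "\<dots> = (if H \<omega> \<in> B then (\<Sum>j\<in>S. p h (X (t k) \<omega>) j * g j) else 0)"
      using fin \<Pi> by (simp add: sum.delta' H_def)
    finally show ?thesis ..
  qed
  have "(\<integral>\<omega>. (if H \<omega> \<in> B then g (X (t k + h) \<omega>) else 0) \<partial>P)
      = (\<integral>\<omega>. (\<Sum>i\<in>?\<Pi> \<inter> B. \<Sum>j\<in>S. g j * indicator (E i \<inter> J j) \<omega>) \<partial>P)"
    using lhs by (intro Bochner_Integration.integral_cong) auto
  also have "\<dots> = (\<Sum>i\<in>?\<Pi> \<inter> B. \<Sum>j\<in>S. g j * measure P (E i \<inter> J j))"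
    using E J by (subst Bochner_Integration.integral_sum Bochner_Integration.integrable_sum,
        auto intro!: sum.cong Bochner_Integration.integrable_sum simp: Bochner_Integration.integral_sum emeasure_finite less_top[symmetric])
  also have "\<dots> = (\<Sum>i\<in>?\<Pi> \<inter> B. (\<Sum>j\<in>S. p h (i k) j * g j) * measure P (E i))"
    using EJ by (auto intro!: sum.cong simp: sum_distrib_left mult_ac)
  also have "\<dots> = (\<integral>\<omega>. (\<Sum>i\<in>?\<Pi> \<inter> B. (\<Sum>j\<in>S. p h (i k) j * g j) * indicator (E i) \<omega>) \<partial>P)"
    using E by (subst Bochner_Integration.integral_sum) (auto intro!: sum.cong simp: emeasure_finite less_top[symmetric])
  also have "\<dots> = (\<integral>\<omega>. (if H \<omega> \<in> B then (\<Sum>j\<in>S. p h (X (t k) \<omega>) j * g j) else 0) \<partial>P)"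
    using rhs by (intro Bochner_Integration.integral_cong) auto
  finally show ?thesis unfolding H_def .
qed

text \<open>Doob's maximal inequality at finitely many times, by freezing: \<open>U k k\<close> equals \<open>V\<close> along the chain while all
earlier values are below \<open>a\<close>, and equals \<open>a\<close> from then on.  Replacing a value that is at least \<open>a\<close> by \<open>a\<close> can only
lower the expectation, and one step of the chain lowers it too; at the end \<open>U\<close> is at least \<open>a\<close> on the
event in question.\<close>

lemma markov_grid_maximal_inequality:
  fixes V :: "real \<Rightarrow> 's \<Rightarrow> real" and t :: "nat \<Rightarrow> real"
  assumes S: "finite S" and P: "prob_space P"
    and X: "\<And>t. 0 \<le> t \<Longrightarrow> X t \<in> measurable P (count_space S)"
    and markov: "markov_with S p P X"
    and t: "\<And>l. 0 \<le> t l" "mono t"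
    and V0: "\<And>l j. l \<le> m \<Longrightarrow> j \<in> S \<Longrightarrow> 0 \<le> V (t l) j"
    and super: "\<And>l i. l < m \<Longrightarrow> i \<in> S \<Longrightarrow>
       (\<Sum>j\<in>S. p (t (Suc l) - t l) i j * V (t (Suc l)) j) \<le> V (t l) i"
  shows "a * measure P {\<omega>\<in>space P. \<exists>l<m. a \<le> V (t l) (X (t l) \<omega>)} \<le> (\<integral>\<omega>. V (t 0) (X (t 0) \<omega>) \<partial>P)"
proof -
  interpret prob_space P by fact
  define below where "below k \<omega> \<longleftrightarrow> (\<forall>l<k. V (t l) (X (t l) \<omega>) < a)" for k \<omega>
  define U where "U l k \<omega> = (if below l \<omega> then V (t k) (X (t k) \<omega>) else a)" for l k \<omega>
  have hist: "(\<lambda>\<omega>. \<lambda>l\<in>{..k}. X (t l) \<omega>) \<in> measurable P (count_space (PiE {..k} (\<lambda>_. S)))" for k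
    using t by (intro measurable_finite_history S X) auto
  have fin: "finite (PiE {..k} (\<lambda>_. S))" for k :: nat
    using S by (intro finite_PiE) auto
  have below_hist: "below l \<omega> \<longleftrightarrow> (\<lambda>l\<in>{..k}. X (t l) \<omega>) \<in> {f. \<forall>i<l. V (t i) (f i) < a}" if "l \<le> Suc k" for l k \<omega>
    using that by (auto simp: below_def)
  have int: "integrable P (U l k)" if "l \<le> Suc k" for l k
  proof -
    have "U l k = (\<lambda>\<omega>. (\<lambda>f. if \<forall>i<l. V (t i) (f i) < a then V (t k) (f k) else a) (\<lambda>l\<in>{..k}. X (t l) \<omega>))"
      using that by (auto simp: U_def below_def fun_eq_iff)
    then show ?thesis
      using integrable_finite_valued[OF fin hist[of k], of "\<lambda>f. if \<forall>i<l. V (t i) (f i) < a then V (t k) (f k) else a"] by simp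
  qed
  have step: "(\<integral>\<omega>. U (Suc k) (Suc k) \<omega> \<partial>P) \<le> (\<integral>\<omega>. U k k \<omega> \<partial>P)" if k: "k < m" for k
  proof -
    let ?B = "{f. \<forall>i<Suc k. V (t i) (f i) < a}"
    let ?h = "t (Suc k) - t k"
    have eq: "t k + ?h = t (Suc k)" by simp
    let ?in = "\<lambda>\<omega>. (\<lambda>l\<in>{..k}. X (t l) \<omega>) \<in> ?B"
    have b: "below (Suc k) \<omega> \<longleftrightarrow> ?in \<omega>" for \<omega> by (rule below_hist) simp
    have mart: "(\<integral>\<omega>. (if ?in \<omega> then V (t (Suc k)) (X (t (Suc k)) \<omega>) else 0) \<partial>P)
       = (\<integral>\<omega>. (if ?in \<omega> then (\<Sum>j\<in>S. p ?h (X (t k) \<omega>) j * V (t (Suc k)) j) else 0) \<partial>P)"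
      using markov_one_step[where t = t and k = k and h = ?h and B = ?B and g = "V (t (Suc k))", OF S P X markov t(1)]
        monoD[OF t(2)] unfolding eq by simp
    have i1: "integrable P (\<lambda>\<omega>. if ?in \<omega> then V (t (Suc k)) (X (t (Suc k)) \<omega>) else 0)"
    proof -
      have "(\<lambda>\<omega>. if ?in \<omega> then V (t (Suc k)) (X (t (Suc k)) \<omega>) else 0)
          = (\<lambda>\<omega>. (\<lambda>f. if \<forall>i<Suc k. V (t i) (f i) < a then V (t (Suc k)) (f (Suc k)) else 0) (\<lambda>l\<in>{..Suc k}. X (t l) \<omega>))"
        by (auto simp: fun_eq_iff)
      then show ?thesis
        using integrable_finite_valued[OF fin hist[of "Suc k"], of "\<lambda>f. if \<forall>i<Suc k. V (t i) (f i) < a then V (t (Suc k)) (f (Suc k)) else 0"] by simp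
    qed
    have i2: "integrable P (\<lambda>\<omega>. if ?in \<omega> then F (X (t k) \<omega>) else 0)" for F :: "'s \<Rightarrow> real"
    proof -
      have "(\<lambda>\<omega>. if ?in \<omega> then F (X (t k) \<omega>) else 0)
          = (\<lambda>\<omega>. (\<lambda>f. if f \<in> ?B then F (f k) else 0) (\<lambda>l\<in>{..k}. X (t l) \<omega>))"
        by (auto simp: fun_eq_iff)
      then show ?thesis
        using integrable_finite_valued[OF fin hist[of k], of "\<lambda>f. if f \<in> ?B then F (f k) else 0"] by simp
    qed
    have i3: "integrable P (\<lambda>\<omega>. if ?in \<omega> then 0 else a)"
      using integrable_finite_valued[OF fin hist[of k], of "\<lambda>f. if f \<in> ?B then 0 else a"] by simp
    have Xk: "X (t k) \<omega> \<in> S" if "\<omega> \<in> space P" for \<omega>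
      using measurable_space[OF X[OF t(1)] that] by simp
    have "(\<integral>\<omega>. U (Suc k) (Suc k) \<omega> \<partial>P)
        = (\<integral>\<omega>. (if ?in \<omega> then V (t (Suc k)) (X (t (Suc k)) \<omega>) else 0) + (if ?in \<omega> then 0 else a) \<partial>P)"
    proof (intro Bochner_Integration.integral_cong refl)
      fix \<omega>
      show "U (Suc k) (Suc k) \<omega>
          = (if ?in \<omega> then V (t (Suc k)) (X (t (Suc k)) \<omega>) else 0) + (if ?in \<omega> then 0 else a)"
        by (cases "?in \<omega>") (simp_all only: U_def b if_True if_False add_0_left add_0_right)
    qed
    also have "\<dots> = (\<integral>\<omega>. (if ?in \<omega> then (\<Sum>j\<in>S. p ?h (X (t k) \<omega>) j * V (t (Suc k)) j) else 0) + (if ?in \<omega> then 0 else a) \<partial>P)"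
      using mart i1 i2[of "\<lambda>x. \<Sum>j\<in>S. p ?h x j * V (t (Suc k)) j"] i3
      by (simp only: Bochner_Integration.integral_add)
    also have "\<dots> \<le> (\<integral>\<omega>. U k k \<omega> \<partial>P)"
    proof (rule integral_mono)
      show "integrable P (U k k)" using int[of k k] by simp
      fix \<omega> assume "\<omega> \<in> space P"
      then show "(if ?in \<omega> then (\<Sum>j\<in>S. p ?h (X (t k) \<omega>) j * V (t (Suc k)) j) else 0) + (if ?in \<omega> then 0 else a) \<le> U k k \<omega>"
        using super[OF k Xk] unfolding b[symmetric] by (auto simp: U_def below_def less_Suc_eq not_less)
    qed (intro Bochner_Integration.integrable_add i2[of "\<lambda>x. \<Sum>j\<in>S. p ?h x j * V (t (Suc k)) j"] i3)
    finally show ?thesis .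
  qed
  have mono: "(\<integral>\<omega>. U k k \<omega> \<partial>P) \<le> (\<integral>\<omega>. U 0 0 \<omega> \<partial>P)" if "k \<le> m" for k
    using that by (induction k) (auto intro: order_trans[OF step])
  have meas: "{\<omega>\<in>space P. \<not> below m \<omega>} \<in> sets P"
  proof -
    have "{\<omega>\<in>space P. \<not> below m \<omega>} = (\<lambda>\<omega>. \<lambda>l\<in>{..m}. X (t l) \<omega>) -` ({f. \<exists>i<m. a \<le> V (t i) (f i)} \<inter> PiE {..m} (\<lambda>_. S)) \<inter> space P"
      using measurable_space[OF hist[of m]] by (force simp: below_def not_less)
    also have "\<dots> \<in> sets P" by (rule measurable_sets[OF hist]) simp
    finally show ?thesis .
  qed
  have "a * measure P {\<omega>\<in>space P. \<not> below m \<omega>} = (\<integral>\<omega>. a * indicator {\<omega>\<in>space P. \<not> below m \<omega>} \<omega> \<partial>P)"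
    using meas by simp
  also have "\<dots> \<le> (\<integral>\<omega>. U m m \<omega> \<partial>P)"
  proof (rule integral_mono)
    show "integrable P (U m m)" using int[of m m] by simp
    show "integrable P (\<lambda>\<omega>. a * indicator {\<omega>\<in>space P. \<not> below m \<omega>} \<omega>)"
      using meas by (auto simp: emeasure_finite less_top[symmetric])
    fix \<omega> assume "\<omega> \<in> space P"
    then show "a * indicator {\<omega>\<in>space P. \<not> below m \<omega>} \<omega> \<le> U m m \<omega>"
      using V0[of m] measurable_space[OF X[OF t(1)], of \<omega> m] by (auto simp: U_def indicator_def)
  qed
  also have "\<dots> \<le> (\<integral>\<omega>. U 0 0 \<omega> \<partial>P)" by (rule mono) simp
  finally show ?thesis by (simp add: U_def below_def not_less)
qed

text \<open>The events on dyadic grids increase, so the bound passes to their union \<open>E\<close>.  Off \<open>E\<close> the function \<open>V\<close>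
stays below \<open>a\<close> at all dyadic times, and a value above \<open>a\<close> at any other time would persist on an
interval to its right, since the path is locally constant there.\<close>

lemma ctmc_maximal_inequality:
  fixes V V' :: "real \<Rightarrow> 's::topological_space \<Rightarrow> real"
  assumes chain: "finite_ctmc S r P X" and discrete: "\<And>s::'s. open {s}"
    and T: "0 < T"
    and V: "\<And>t j. 0 \<le> t \<Longrightarrow> t \<le> T \<Longrightarrow> j \<in> S \<Longrightarrow> ((\<lambda>t. V t j) has_real_derivative V' t j) (at t)"
    and V0: "\<And>t j. 0 \<le> t \<Longrightarrow> t \<le> T \<Longrightarrow> j \<in> S \<Longrightarrow> 0 \<le> V t j"
    and super: "\<And>t i. 0 \<le> t \<Longrightarrow> t \<le> T \<Longrightarrow> i \<in> S \<Longrightarrow>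
                  V' t i + (\<Sum>j\<in>S. generator S r i j * V t j) \<le> 0"
  obtains E where "E \<in> sets P" "a * measure P E \<le> (\<integral>\<omega>. V 0 (X 0 \<omega>) \<partial>P)"
    "\<And>\<omega> t. \<omega> \<in> space P \<Longrightarrow> \<omega> \<notin> E \<Longrightarrow> t \<in> {0..T} \<Longrightarrow> V t (X t \<omega>) \<le> a"
proof -
  obtain p where S: "finite S" and P: "prob_space P"
    and X: "\<And>t. 0 \<le> t \<Longrightarrow> X t \<in> measurable P (count_space S)"
    and cadlag: "\<And>\<omega>. \<omega> \<in> space P \<Longrightarrow> cadlag_on {0..} (\<lambda>t. X t \<omega>)"
    and p: "transition_semigroup S p" "has_rates S p r" and markov: "markov_with S p P X"
    using chain by (auto simp: finite_ctmc_def)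
  interpret prob_space P by fact
  \<comment> \<open>Truncation at \<open>T\<close> makes every grid point admissible, also for indices beyond \<open>2 ^ N\<close>, which
    would otherwise leave the domain of \<open>V\<close>.\<close>
  define grid where "grid N l = min T (T * real l / 2 ^ N)" for N l :: nat
  define E where "E N = {\<omega>\<in>space P. \<exists>l<Suc (2 ^ N). a \<le> V (grid N l) (X (grid N l) \<omega>)}" for N :: nat
  have grid: "0 \<le> grid N l" "grid N l \<le> T" "mono (grid N)" for N l
  proof -
    have "0 \<le> T * real l / 2 ^ N" using T by simp
    then show "0 \<le> grid N l" "grid N l \<le> T" using T by (simp_all add: grid_def)
    show "mono (grid N)"
      unfolding grid_def using T by (intro monoI min.mono divide_right_mono) auto
  qed
  have refine: "grid N l = grid (Suc N) (2 * l)" for N l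
    by (simp add: grid_def)
  have meas: "E N \<in> sets P" for N
  proof -
    have "E N = (\<Union>l<Suc (2 ^ N). X (grid N l) -` {j\<in>S. a \<le> V (grid N l) j} \<inter> space P)"
      using measurable_space[OF X[OF grid(1)]] by (fastforce simp: E_def)
    also have "\<dots> \<in> sets P"
    proof (rule sets.finite_UN)
      fix l
      show "X (grid N l) -` {j\<in>S. a \<le> V (grid N l) j} \<inter> space P \<in> sets P"
        by (rule measurable_sets[OF X[OF grid(1)]]) simp
    qed simp
    finally show ?thesis .
  qed
  have inc: "incseq E"
  proof (rule incseq_SucI, rule subsetI)
    fix N \<omega> assume "\<omega> \<in> E N"
    then obtain l where "\<omega> \<in> space P" "l < Suc (2 ^ N)" "a \<le> V (grid N l) (X (grid N l) \<omega>)"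
      by (auto simp: E_def)
    then show "\<omega> \<in> E (Suc N)" unfolding E_def refine[of N l]
      by (intro CollectI conjI exI[of _ "2 * l"]) auto
  qed
  have bound: "a * measure P (E N) \<le> (\<integral>\<omega>. V 0 (X 0 \<omega>) \<partial>P)" for N
  proof -
    have "(\<Sum>j\<in>S. p (grid N (Suc l) - grid N l) i j * V (grid N (Suc l)) j) \<le> V (grid N l) i" if "i \<in> S" for i l
      using semigroup_supersolution[where V = V and V' = V' and T = T and s = "grid N l"
          and h = "grid N (Suc l) - grid N l" and i = i, OF S p V super]
        grid(1,2)[of N "Suc l"] grid(1,2)[of N l] monoD[OF grid(3)[of N], of l "Suc l"] that by simp
    then have "a * measure P (E N) \<le> (\<integral>\<omega>. V (grid N 0) (X (grid N 0) \<omega>) \<partial>P)"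
      unfolding E_def using grid V0 by (intro markov_grid_maximal_inequality[OF S P X markov]) auto
    then show ?thesis using T by (simp add: grid_def)
  qed
  have "(\<lambda>N. a * measure P (E N)) \<longlonglongrightarrow> a * measure P (\<Union>N. E N)"
    using meas inc by (intro tendsto_mult_left finite_Lim_measure_incseq) auto
  then have "a * measure P (\<Union>N. E N) \<le> (\<integral>\<omega>. V 0 (X 0 \<omega>) \<partial>P)"
    using bound by (intro LIMSEQ_le_const2) auto
  moreover have "(\<Union>N. E N) \<in> sets P" using meas by auto
  moreover have "V t (X t \<omega>) \<le> a" if \<omega>: "\<omega> \<in> space P" "\<omega> \<notin> (\<Union>N. E N)" and t: "t \<in> {0..T}" for \<omega> t
  proof (rule ccontr)
    assume "\<not> V t (X t \<omega>) \<le> a"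
    then have gt: "a < V t (X t \<omega>)" by simp
    have good: "V (grid N l) (X (grid N l) \<omega>) < a" if "l \<le> 2 ^ N" for N l
      using \<omega> that by (force simp: E_def not_le)
    show False
    proof (cases "t = T")
      case True
      then show False using good[of 1 0] gt by (simp add: grid_def)
    next
      case False
      with t have tT: "0 \<le> t" "t < T" by auto
      have "X t \<omega> \<in> S" using measurable_space[OF X[OF tT(1)] \<omega>(1)] by simp
      then have "((\<lambda>s. V s (X t \<omega>)) \<longlongrightarrow> V t (X t \<omega>)) (at t within {0..} \<inter> {t<..})"
        using DERIV_isCont[OF V[of t "X t \<omega>"]] tT
        by (auto simp: isCont_def intro: tendsto_within_subset)
      then have "\<forall>\<^sub>F s in at t within {0..} \<inter> {t<..}. a < V s (X t \<omega>)"
        using gt by (rule order_tendstoD)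
      moreover have "\<forall>\<^sub>F s in at t within {0..} \<inter> {t<..}. X s \<omega> \<in> {X t \<omega>}"
        using cadlag[OF \<omega>(1)] tT discrete by (intro topological_tendstoD) (auto simp: cadlag_on_def)
      ultimately have "\<forall>\<^sub>F s in at t within {0..} \<inter> {t<..}. a < V s (X s \<omega>)"
        by eventually_elim auto
      then obtain d where d: "0 < d" "\<And>s. t < s \<Longrightarrow> s < t + d \<Longrightarrow> a < V s (X s \<omega>)"
        using tT unfolding eventually_at by (auto simp: dist_real_def)
      obtain N :: nat where N: "T / d < 2 ^ N"
        using real_arch_pow[of 2 "T / d"] by auto
      \<comment> \<open>the first grid point strictly to the right of \<open>t\<close>\<close>
      define l where "l = nat \<lfloor>t * 2 ^ N / T\<rfloor> + 1"
      have l: "real l = of_int \<lfloor>t * 2 ^ N / T\<rfloor> + 1" using tT by (simp add: l_def)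
      have "t * 2 ^ N / T < real l" "real l \<le> t * 2 ^ N / T + 1" unfolding l by linarith+
      then have lt: "t < T * real l / 2 ^ N" "T * real l / 2 ^ N \<le> t + T / 2 ^ N"
        using T by (auto simp: field_simps)
      have "t * 2 ^ N / T < 2 ^ N" using tT T by (simp add: field_simps)
      then have "\<lfloor>t * 2 ^ N / T\<rfloor> < 2 ^ N" by (simp add: floor_less_iff)
      then have l2: "l \<le> 2 ^ N" unfolding l_def by (simp add: nat_less_iff Suc_le_eq tT T)
      have "T / 2 ^ N < d" using N d T by (simp add: field_simps)
      then have "grid N l < t + d" "t < grid N l" using lt tT unfolding grid_def by auto
      then show False using d(2) good[OF l2] by force
    qed
  qed
  ultimately show ?thesis using that by blast
qed

section \<open>Step paths in the Skorokhod space\<close>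

text \<open>The set \<open>J\<close> contains the possible jump times; a path value depends only on the jumps that have occurred.
The end points are included so that a perturbation that moves only points of \<open>J\<close> onto a grid
containing \<open>0\<close> and \<open>T\<close> keeps them fixed.\<close>

definition step_path :: "real \<Rightarrow> real set \<Rightarrow> (real \<Rightarrow> 'b) \<Rightarrow> bool" where
  "step_path T J x \<longleftrightarrow> finite J \<and> {0, T} \<subseteq> J \<and> J \<subseteq> {0..T} \<and>
     (\<forall>s\<in>{0..T}. \<forall>t\<in>{0..T}. (\<forall>\<tau>\<in>J. \<tau> \<le> s \<longleftrightarrow> \<tau> \<le> t) \<longrightarrow> x s = x t)"

lemma step_path_compose: "step_path T J x \<Longrightarrow> step_path T J (\<lambda>t. g (x t))"
  unfolding step_path_def by metis

text \<open>Around every time \<open>c\<close> there is an interval on which the path is constant on \<open>[c, \<dots>)\<close> and on \<open>(\<dots>, c)\<close>.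
Finitely many of these intervals cover \<open>[0, T]\<close>, and between neighbouring centres the path is locally
constant, hence constant.\<close>

lemma cadlag_discrete_imp_step_path:
  fixes x :: "real \<Rightarrow> 'b::topological_space"
  assumes x: "cadlag_on {0..} x" and discrete: "\<And>s::'b. open {s}" and T: "0 \<le> T"
  shows "\<exists>J. step_path T J x"
proof -
  have "\<exists>d l. 0 < d \<and> (\<forall>s. t \<le> s \<and> s < t + d \<longrightarrow> x s = x t) \<and> (\<forall>s. 0 \<le> s \<and> t - d < s \<and> s < t \<longrightarrow> x s = l)"
    if t: "t \<in> {0..T}" for t
  proof -
    obtain l where r: "(x \<longlongrightarrow> x t) (at t within {0..} \<inter> {t<..})"
      and l: "(x \<longlongrightarrow> l) (at t within {0..} \<inter> {..<t})"
      using x t unfolding cadlag_on_def by fastforce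
    have "eventually (\<lambda>s. x s \<in> {x t}) (at t within {0..} \<inter> {t<..})"
      using discrete by (intro topological_tendstoD[OF r]) auto
    then obtain d1 where d1: "0 < d1" "\<And>s. t < s \<Longrightarrow> s < t + d1 \<Longrightarrow> x s = x t"
      using t unfolding eventually_at by (auto simp: dist_real_def)
    have "eventually (\<lambda>s. x s \<in> {l}) (at t within {0..} \<inter> {..<t})"
      using discrete by (intro topological_tendstoD[OF l]) auto
    then obtain d2 where d2: "0 < d2" "\<And>s. 0 \<le> s \<Longrightarrow> t - d2 < s \<Longrightarrow> s < t \<Longrightarrow> x s = l"
      using t unfolding eventually_at by (auto simp: dist_real_def)
    show ?thesis
    proof (intro exI conjI allI impI)
      show "0 < min d1 d2" using d1(1) d2(1) by simp
      show "x s = x t" if "t \<le> s \<and> s < t + min d1 d2" for s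
        using d1(2)[of s] that by (cases "s = t") auto
      show "x s = l" if "0 \<le> s \<and> t - min d1 d2 < s \<and> s < t" for s
        using d2(2)[of s] that by auto
    qed
  qed
  then obtain d l where d: "\<And>t. t \<in> {0..T} \<Longrightarrow> 0 < d t"
    and right: "\<And>t s. t \<in> {0..T} \<Longrightarrow> t \<le> s \<Longrightarrow> s < t + d t \<Longrightarrow> x s = x t"
    and left: "\<And>t s. t \<in> {0..T} \<Longrightarrow> 0 \<le> s \<Longrightarrow> t - d t < s \<Longrightarrow> s < t \<Longrightarrow> x s = l t"
    by metis
  obtain C where C: "C \<subseteq> {0..T}" "finite C" "{0..T} \<subseteq> (\<Union>c\<in>C. {c - d c<..<c + d c})"
  proof (rule compactE_image[of "{0..T}" "{0..T}" "\<lambda>c. {c - d c<..<c + d c}"])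
    have "c \<in> {c - d c<..<c + d c}" if "c \<in> {0..T}" for c using d[OF that] by simp
    then show "{0..T} \<subseteq> (\<Union>c\<in>{0..T}. {c - d c<..<c + d c})" by blast
  qed auto
  have const: "x s = x t" if st: "0 \<le> s" "s \<le> t" "t \<le> T" and between: "\<And>c. c \<in> C \<Longrightarrow> c \<le> s \<longleftrightarrow> c \<le> t" for s t
  proof -
    have "x constant_on {s..t}"
    proof (rule locally_constant_imp_constant)
      fix u assume u: "u \<in> {s..t}"
      then have "u \<in> (\<Union>c\<in>C. {c - d c<..<c + d c})" using C(3) st by (intro subsetD[OF C(3)]) auto
      then obtain c where c: "c \<in> C" "u \<in> {c - d c<..<c + d c}" by blast
      have cT: "c \<in> {0..T}" using c C by auto
      have "x v = x u" if v: "v \<in> {s..t} \<inter> {c - d c<..<c + d c}" for v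
      proof (cases "c \<le> s")
        case True
        then show ?thesis using right[OF cT, of u] right[OF cT, of v] u v c(2) by simp
      next
        case False
        then have "t < c" using between[OF c(1)] by simp
        then show ?thesis using left[OF cT, of u] left[OF cT, of v] u v c(2) st by simp
      qed
      moreover have "openin (top_of_set {s..t}) ({s..t} \<inter> {c - d c<..<c + d c})"
        by (intro openin_open_Int) simp
      ultimately show "\<exists>U. openin (top_of_set {s..t}) U \<and> u \<in> U \<and> (\<forall>v\<in>U. x v = x u)"
        using u c(2) by blast
    qed simp
    then show ?thesis using st unfolding constant_on_def by (metis atLeastAtMost_iff order_refl)
  qed
  have "step_path T (insert 0 (insert T C)) x"
    unfolding step_path_def
  proof (intro conjI ballI impI)
    fix s t assume "s \<in> {0..T}" "t \<in> {0..T}" "\<forall>\<tau>\<in>insert 0 (insert T C). \<tau> \<le> s \<longleftrightarrow> \<tau> \<le> t"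
    then have "0 \<le> s" "s \<le> T" "0 \<le> t" "t \<le> T" "\<And>c. c \<in> C \<Longrightarrow> c \<le> s \<longleftrightarrow> c \<le> t" by simp_all
    then show "x s = x t"
      by (cases s t rule: linorder_le_cases) (rule const const[symmetric]; simp)+
  qed (use C T in auto)
  then show ?thesis by blast
qed

lemma step_path_imp_cadlag:
  fixes x :: "real \<Rightarrow> 'b::topological_space"
  assumes "step_path T J x"
  shows "cadlag_on {0..T} x"
  unfolding cadlag_on_def
proof (intro ballI conjI)
  have J: "finite J" using assms by (simp add: step_path_def)
  have const: "x s = x t"
    if "s \<in> {0..T}" "t \<in> {0..T}" "\<And>\<tau>. \<tau> \<in> J \<Longrightarrow> \<tau> \<le> s \<longleftrightarrow> \<tau> \<le> t" for s t
    using assms that unfolding step_path_def by simp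
  fix t assume t: "t \<in> {0..T}"
  have "eventually (\<lambda>s. \<forall>\<tau>\<in>J. \<tau> \<le> s \<longleftrightarrow> \<tau> \<le> t) (at t within {0..T} \<inter> {t<..})"
  proof (rule eventually_ball_finite[OF J], rule ballI)
    fix \<tau> assume "\<tau> \<in> J"
    show "eventually (\<lambda>s. \<tau> \<le> s \<longleftrightarrow> \<tau> \<le> t) (at t within {0..T} \<inter> {t<..})"
    proof (cases "\<tau> \<le> t")
      case True
      then show ?thesis by (auto simp: eventually_at_filter)
    next
      case False
      then show ?thesis
        unfolding eventually_at by (intro exI[of _ "\<tau> - t"]) (auto simp: dist_real_def)
    qed
  qed
  moreover have "eventually (\<lambda>s. s \<in> {0..T}) (at t within {0..T} \<inter> {t<..})"
    by (auto simp: eventually_at_filter)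
  ultimately have "eventually (\<lambda>s. x t = x s) (at t within {0..T} \<inter> {t<..})"
    by eventually_elim (rule const, use t in auto)
  then show "(x \<longlongrightarrow> x t) (at t within {0..T} \<inter> {t<..})"
    by (rule Lim_transform_eventually[OF tendsto_const])
  have "eventually (\<lambda>s. \<forall>\<tau>\<in>J. \<tau> \<le> s \<longleftrightarrow> \<tau> < t) (at t within {0..T} \<inter> {..<t})"
  proof (rule eventually_ball_finite[OF J], rule ballI)
    fix \<tau> assume "\<tau> \<in> J"
    show "eventually (\<lambda>s. \<tau> \<le> s \<longleftrightarrow> \<tau> < t) (at t within {0..T} \<inter> {..<t})"
    proof (cases "\<tau> < t")
      case False
      then show ?thesis by (auto simp: eventually_at_filter)
    next
      case True
      then show ?thesis
        unfolding eventually_at by (intro exI[of _ "t - \<tau>"]) (auto simp: dist_real_def)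
    qed
  qed
  then obtain d where "0 < d" and
    near: "\<forall>s\<in>{0..T} \<inter> {..<t}. s \<noteq> t \<and> dist s t < d \<longrightarrow> (\<forall>\<tau>\<in>J. \<tau> \<le> s \<longleftrightarrow> \<tau> < t)"
    unfolding eventually_at by blast
  have d: "\<tau> \<le> s \<longleftrightarrow> \<tau> < t" if "0 \<le> s" "s < t" "t - d < s" "\<tau> \<in> J" for s \<tau>
  proof -
    have "s \<in> {0..T} \<inter> {..<t}" "s \<noteq> t \<and> dist s t < d" using that t by (auto simp: dist_real_def)
    then show ?thesis using near that(4) by blast
  qed
  show "\<exists>l. (x \<longlongrightarrow> l) (at t within {0..T} \<inter> {..<t})"
  proof (intro exI Lim_transform_eventually[OF tendsto_const])
    show "eventually (\<lambda>s. x (max 0 (t - d / 2)) = x s) (at t within {0..T} \<inter> {..<t})"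
      unfolding eventually_at
    proof (intro exI[of _ d] conjI ballI impI)
      fix s assume s: "s \<in> {0..T} \<inter> {..<t}" "s \<noteq> t \<and> dist s t < d"
      show "x (max 0 (t - d / 2)) = x s"
      proof (rule const)
        have s': "0 \<le> s" "s < t" "t - d < s" using s by (auto simp: dist_real_def)
        then have m: "0 \<le> max 0 (t - d / 2)" "max 0 (t - d / 2) < t" "t - d < max 0 (t - d / 2)"
          using \<open>0 < d\<close> by auto
        show "max 0 (t - d / 2) \<in> {0..T}" using m(1,2) t by simp
        show "\<tau> \<le> max 0 (t - d / 2) \<longleftrightarrow> \<tau> \<le> s" if "\<tau> \<in> J" for \<tau>
          by (simp only: d[OF s' that] d[OF m that])
      qed (use s in simp)
    qed (rule \<open>0 < d\<close>)
  qed
qed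

definition grid_floor :: "real \<Rightarrow> nat \<Rightarrow> real \<Rightarrow> real" where
  "grid_floor T m t = T * of_int \<lfloor>t * real m / T\<rfloor> / real m"

definition grid_ceiling :: "real \<Rightarrow> nat \<Rightarrow> real \<Rightarrow> real" where
  "grid_ceiling T m t = T * of_int \<lceil>t * real m / T\<rceil> / real m"

text \<open>Rounding time down after a jump has been moved up to the grid sees the jump at the right moment; this
is why the sampled path below is an exact time change of the original one.\<close>

lemma grid_galois:
  assumes "0 < T" "0 < m"
  shows "\<tau> \<le> grid_floor T m s \<longleftrightarrow> grid_ceiling T m \<tau> \<le> s"
proof -
  have "\<tau> \<le> grid_floor T m s \<longleftrightarrow> \<tau> * real m / T \<le> of_int \<lfloor>s * real m / T\<rfloor>"
    using assms by (simp add: grid_floor_def field_simps)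
  also have "\<dots> \<longleftrightarrow> of_int \<lceil>\<tau> * real m / T\<rceil> \<le> s * real m / T"
    by (simp add: ceiling_le_iff[symmetric] le_floor_iff[symmetric])
  also have "\<dots> \<longleftrightarrow> grid_ceiling T m \<tau> \<le> s"
    using assms by (simp add: grid_ceiling_def field_simps)
  finally show ?thesis .
qed

lemma grid_floor_in:
  assumes "0 < T" "0 < m" "s \<in> {0..T}"
  shows "grid_floor T m s \<in> (\<lambda>i. T * real i / real m) ` {..m}"
proof -
  have a: "0 \<le> s * real m / T" "s * real m / T \<le> real m" using assms by (auto simp: divide_le_eq mult.commute)
  then have "0 \<le> \<lfloor>s * real m / T\<rfloor>" "\<lfloor>s * real m / T\<rfloor> \<le> int m" by (auto simp: floor_le_iff)
  then show ?thesis
    unfolding grid_floor_def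
    by (intro image_eqI[of _ _ "nat \<lfloor>s * real m / T\<rfloor>"]) (auto simp: nat_le_iff)
qed

lemma grid_floor_mem:
  assumes "0 < T" "0 < m" "s \<in> {0..T}"
  shows "grid_floor T m s \<in> {0..T}"
  using grid_floor_in[OF assms] assms by (auto simp: divide_le_eq)

lemma grid_ceiling_near:
  assumes "0 < T" "0 < m"
  shows "0 \<le> grid_ceiling T m t - t" "grid_ceiling T m t - t \<le> T / m"
proof -
  have eq: "grid_ceiling T m t - t = (T / m) * (of_int \<lceil>t * real m / T\<rceil> - t * real m / T)"
    using assms by (simp add: grid_ceiling_def field_simps)
  have b: "0 \<le> of_int \<lceil>t * real m / T\<rceil> - t * real m / T" "of_int \<lceil>t * real m / T\<rceil> - t * real m / T \<le> 1"
    by linarith+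
  show "0 \<le> grid_ceiling T m t - t" unfolding eq using b assms by simp
  show "grid_ceiling T m t - t \<le> T / m" unfolding eq using b assms by (intro mult_left_le) auto
qed

lemma grid_floor_step_path:
  assumes "0 < T" "0 < m"
  shows "step_path T ((\<lambda>i. T * real i / real m) ` {..m}) (\<lambda>s. x (grid_floor T m s))"
proof -
  have "grid_floor T m s \<le> grid_floor T m t"
    if s: "s \<in> {0..T}" and t: "t \<in> {0..T}" and le: "\<forall>\<tau>\<in>(\<lambda>i. T * real i / real m) ` {..m}. \<tau> \<le> s \<longleftrightarrow> \<tau> \<le> t" for s t
  proof -
    have "grid_floor T m s \<le> s"
      using grid_galois[OF assms, of "grid_floor T m s" s]
        grid_ceiling_near(1)[OF assms, of "grid_floor T m s"] by simp
    then have "grid_floor T m s \<le> t" using le grid_floor_in[OF assms s] by blast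
    then have "of_int \<lfloor>s * real m / T\<rfloor> \<le> t * real m / T"
      using assms by (simp add: grid_floor_def field_simps)
    then have "\<lfloor>s * real m / T\<rfloor> \<le> \<lfloor>t * real m / T\<rfloor>" by (simp add: le_floor_iff)
    then show ?thesis using assms by (simp add: grid_floor_def divide_right_mono)
  qed
  then have "x (grid_floor T m s) = x (grid_floor T m t)"
    if "s \<in> {0..T}" "t \<in> {0..T}" "\<forall>\<tau>\<in>(\<lambda>i. T * real i / real m) ` {..m}. \<tau> \<le> s \<longleftrightarrow> \<tau> \<le> t" for s t
    using that by (metis order_antisym)
  moreover have "0 \<in> (\<lambda>i. T * real i / real m) ` {..m}" "T \<in> (\<lambda>i. T * real i / real m) ` {..m}"
    using assms by (auto intro: image_eqI[of _ _ 0] image_eqI[of _ _ m])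
  moreover have "(\<lambda>i. T * real i / real m) ` {..m} \<subseteq> {0..T}"
    using assms by (auto simp: divide_le_eq)
  ultimately show ?thesis unfolding step_path_def by auto
qed

text \<open>A step path and its sample on a fine grid take the same values in the same order; only the jumps are
delayed to the next grid point.  The time change that realises the delay adds to the identity a tent of
width \<open>w\<close> at each jump, where \<open>w\<close> is the smallest gap between points of \<open>J\<close>: then the tents do not influence one
another at the jumps, and the sum is strictly increasing as soon as the total height of the tents is
smaller than \<open>w\<close>.\<close>

lemma step_path_grid_close:
  fixes x :: "real \<Rightarrow> real"
  assumes x: "step_path T J x" and T: "0 < T"
  shows "\<exists>m0>0. \<forall>m\<ge>m0. skorokhod_close T x (\<lambda>s. x (grid_floor T m s)) (real (card J) * (T / real m))"
proof -
  have J: "finite J" "0 \<in> J" "T \<in> J" "J \<subseteq> {0..T}"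
    using x by (simp_all add: step_path_def)
  have const: "x s = x t"
    if "s \<in> {0..T}" "t \<in> {0..T}" "\<And>\<tau>. \<tau> \<in> J \<Longrightarrow> \<tau> \<le> s \<longleftrightarrow> \<tau> \<le> t" for s t
    using x that unfolding step_path_def by simp
  define w where "w = Min ((\<lambda>(\<sigma>, \<tau>). \<bar>\<sigma> - \<tau>\<bar>) ` {(\<sigma>, \<tau>). \<sigma> \<in> J \<and> \<tau> \<in> J \<and> \<sigma> \<noteq> \<tau>})"
  have finJJ: "finite {(\<sigma>, \<tau>). \<sigma> \<in> J \<and> \<tau> \<in> J \<and> \<sigma> \<noteq> \<tau>}"
    by (rule finite_subset[of _ "J \<times> J"]) (use J in auto)
  have neJJ: "(0, T) \<in> {(\<sigma>, \<tau>). \<sigma> \<in> J \<and> \<tau> \<in> J \<and> \<sigma> \<noteq> \<tau>}" using J T by auto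
  have w: "0 < w" unfolding w_def using finJJ neJJ by (subst Min_gr_iff) auto
  have gap: "w \<le> \<bar>\<sigma> - \<tau>\<bar>" if "\<sigma> \<in> J" "\<tau> \<in> J" "\<sigma> \<noteq> \<tau>" for \<sigma> \<tau>
    unfolding w_def using finJJ that by (intro Min_le) force+
  obtain m0 :: nat where m0: "real (card J) * T / w < real m0" using reals_Archimedean2 by blast
  have "skorokhod_close T x (\<lambda>s. x (grid_floor T m s)) (real (card J) * (T / real m))"
    if m: "Suc m0 \<le> m" for m
  proof -
    have m_pos: "0 < m" using m by simp
    define e where "e \<tau> = grid_ceiling T m \<tau> - \<tau>" for \<tau>
    define tent where "tent \<tau> t = max 0 (1 - \<bar>t - \<tau>\<bar> / w)" for \<tau> t :: real
    define \<theta> where "\<theta> t = t + (\<Sum>\<tau>\<in>J. e \<tau> * tent \<tau> t)" for t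
    have e: "0 \<le> e \<tau>" "e \<tau> \<le> T / m" for \<tau>
      using grid_ceiling_near[OF T m_pos] by (auto simp: e_def)
    have tent01: "0 \<le> tent \<tau> t" "tent \<tau> t \<le> 1" for \<tau> t using w by (auto simp: tent_def)
    have tent_lip: "\<bar>tent \<tau> s - tent \<tau> t\<bar> \<le> \<bar>s - t\<bar> / w" for \<tau> s t
    proof -
      have "\<bar>tent \<tau> s - tent \<tau> t\<bar> \<le> \<bar>\<bar>s - \<tau>\<bar> / w - \<bar>t - \<tau>\<bar> / w\<bar>" unfolding tent_def by linarith
      also have "\<dots> = \<bar>\<bar>s - \<tau>\<bar> - \<bar>t - \<tau>\<bar>\<bar> / w" using w by (simp add: abs_divide flip: diff_divide_distrib)
      also have "\<dots> \<le> \<bar>s - t\<bar> / w" using w by (intro divide_right_mono) linarith+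
      finally show ?thesis .
    qed
    have at_jump: "\<theta> \<tau> = grid_ceiling T m \<tau>" if "\<tau> \<in> J" for \<tau>
    proof -
      have "tent \<sigma> \<tau> = (if \<sigma> = \<tau> then 1 else 0)" if "\<sigma> \<in> J" for \<sigma>
        using gap[OF \<open>\<tau> \<in> J\<close> that] w by (auto simp: tent_def)
      then have "(\<Sum>\<sigma>\<in>J. e \<sigma> * tent \<sigma> \<tau>) = (\<Sum>\<sigma>\<in>J. if \<sigma> = \<tau> then e \<sigma> else 0)"
        by (intro sum.cong) auto
      then show ?thesis using that J by (simp add: \<theta>_def e_def)
    qed
    have ends: "\<theta> 0 = 0" "\<theta> T = T"
      using at_jump[of 0] at_jump[of T] J T m_pos by (simp_all add: grid_ceiling_def)
    have small: "(\<Sum>\<tau>\<in>J. e \<tau>) \<le> real (card J) * (T / m)"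
      using sum_bounded_above[of J e "T / m"] e by simp
    have small_w: "(\<Sum>\<tau>\<in>J. e \<tau>) / w < 1"
    proof -
      have "real m0 < real m" using m by simp
      with m0 have "real (card J) * T / w < real m" by linarith
      then have "real (card J) * (T / m) < w" using w m_pos by (simp add: field_simps)
      with small w show ?thesis by simp
    qed
    have mono: "\<theta> s < \<theta> t" if st: "s < t" for s t
    proof -
      have "(\<Sum>\<tau>\<in>J. e \<tau> * tent \<tau> s) - (\<Sum>\<tau>\<in>J. e \<tau> * tent \<tau> t) = (\<Sum>\<tau>\<in>J. e \<tau> * (tent \<tau> s - tent \<tau> t))"
        by (simp add: right_diff_distrib sum_subtractf)
      also have "\<dots> \<le> (\<Sum>\<tau>\<in>J. e \<tau> * ((t - s) / w))"
        using tent_lip[of _ s t] st e(1) by (intro sum_mono mult_left_mono) (auto simp: abs_le_iff)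
      also have "\<dots> = ((\<Sum>\<tau>\<in>J. e \<tau>) / w) * (t - s)"
        by (simp add: sum_distrib_right sum_divide_distrib)
      also have "\<dots> < t - s" using mult_strict_right_mono[OF small_w, of "t - s"] st by simp
      finally show ?thesis by (simp add: \<theta>_def)
    qed
    have cont: "continuous_on {0..T} \<theta>"
      unfolding \<theta>_def tent_def using w by (intro continuous_intros) auto
    have image: "\<theta> ` {0..T} = {0..T}"
    proof
      show "\<theta> ` {0..T} \<subseteq> {0..T}"
      proof (rule image_subsetI)
        fix t assume "t \<in> {0..T}"
        then show "\<theta> t \<in> {0..T}"
          using mono[of 0 t] mono[of t T] ends by (cases "t = 0"; cases "t = T") auto
      qed
      show "{0..T} \<subseteq> \<theta> ` {0..T}"
      proof
        fix s assume "s \<in> {0..T}"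
        then show "s \<in> \<theta> ` {0..T}"
          using IVT'[of \<theta> 0 s T] ends cont T by auto
      qed
    qed
    have tc: "\<theta> \<in> time_changes T"
      using mono cont image by (auto simp: time_changes_def strict_mono_on_def)
    have "\<bar>\<theta> t - t\<bar> \<le> real (card J) * (T / m) \<and> \<bar>x t - x (grid_floor T m (\<theta> t))\<bar> \<le> real (card J) * (T / m)"
      if t: "t \<in> {0..T}" for t
    proof
      have "0 \<le> (\<Sum>\<tau>\<in>J. e \<tau> * tent \<tau> t)" using e tent01 by (intro sum_nonneg) auto
      moreover have "(\<Sum>\<tau>\<in>J. e \<tau> * tent \<tau> t) \<le> (\<Sum>\<tau>\<in>J. e \<tau>)"
        using e tent01 by (intro sum_mono mult_left_le) auto
      ultimately show "\<bar>\<theta> t - t\<bar> \<le> real (card J) * (T / m)" using small by (simp add: \<theta>_def)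
      have "\<theta> t \<in> {0..T}" using image t by blast
      then have gf: "grid_floor T m (\<theta> t) \<in> {0..T}" by (rule grid_floor_mem[OF T m_pos])
      have "\<tau> \<le> grid_floor T m (\<theta> t) \<longleftrightarrow> \<tau> \<le> t" if "\<tau> \<in> J" for \<tau>
      proof -
        have "\<tau> \<le> grid_floor T m (\<theta> t) \<longleftrightarrow> \<theta> \<tau> \<le> \<theta> t"
          using grid_galois[OF T m_pos] at_jump[OF that] by simp
        also have "\<dots> \<longleftrightarrow> \<tau> \<le> t" using mono[of t \<tau>] mono[of \<tau> t] by force
        finally show ?thesis .
      qed
      then have "x (grid_floor T m (\<theta> t)) = x t" using gf t by (intro const)
      then show "\<bar>x t - x (grid_floor T m (\<theta> t))\<bar> \<le> real (card J) * (T / m)"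
        using T by simp
    qed
    with tc show ?thesis unfolding skorokhod_close_def by blast
  qed
  then show ?thesis by (intro exI[of _ "Suc m0"]) auto
qed

lemma skorokhod_close_cong:
  assumes "\<And>t. t \<in> {0..T} \<Longrightarrow> x t = x' t" "\<And>t. t \<in> {0..T} \<Longrightarrow> y t = y' t"
    and "skorokhod_close T x y e"
  shows "skorokhod_close T x' y' e"
proof -
  obtain \<theta> where th: "\<theta> \<in> time_changes T"
    "\<And>t. t \<in> {0..T} \<Longrightarrow> \<bar>\<theta> t - t\<bar> \<le> e \<and> \<bar>x t - y (\<theta> t)\<bar> \<le> e"
    using assms(3) by (auto simp: skorokhod_close_def)
  have "\<theta> t \<in> {0..T}" if "t \<in> {0..T}" for t using th(1) that by (auto simp: time_changes_def)
  then show ?thesis using th assms(1,2) unfolding skorokhod_close_def by (intro bexI[OF _ th(1)]) force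
qed

lemma step_path_restrict: "step_path T J (restrict x {0..T}) \<longleftrightarrow> step_path T J x"
  by (simp add: step_path_def)

lemma step_path_in_skorokhod_space:
  "step_path T J x \<Longrightarrow> restrict x {0..T} \<in> skorokhod_space T"
  by (simp add: skorokhod_space_def step_path_imp_cadlag step_path_restrict)

lemma path_on_in_skorokhod_space:
  fixes X :: "real \<Rightarrow> 'a \<Rightarrow> 's::topological_space"
  assumes "cadlag_on {0..} (\<lambda>t. X t \<omega>)" "\<And>s::'s. open {s}" "0 \<le> T"
  shows "path_on T (\<lambda>t \<omega>. g (X t \<omega>)) \<omega> \<in> skorokhod_space T"
proof -
  obtain J where "step_path T J (\<lambda>t. X t \<omega>)"
    using cadlag_discrete_imp_step_path[OF assms(1,2,3)] by blast
  then have "step_path T J (\<lambda>t. g (X t \<omega>))" by (rule step_path_compose)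
  from step_path_in_skorokhod_space[OF this] show ?thesis by (simp add: path_on_def)
qed

text \<open>The sampled path \<open>y m\<close> is a function of finitely many states, so the preimage of every set is measurable.
As the samples converge to the path in the Skorokhod metric, the path lies in an open set \<open>U\<close> if and only
if the samples eventually stay at a fixed positive distance inside \<open>U\<close>; this writes the preimage of \<open>U\<close>
with countable set operations.\<close>

lemma path_on_measurable:
  fixes X :: "real \<Rightarrow> 'a \<Rightarrow> 's::topological_space" and g :: "'s \<Rightarrow> real"
  assumes S: "finite S" and X: "\<And>t. 0 \<le> t \<Longrightarrow> X t \<in> measurable P (count_space S)"
    and cadlag: "\<And>\<omega>. \<omega> \<in> space P \<Longrightarrow> cadlag_on {0..} (\<lambda>t. X t \<omega>)"
    and discrete: "\<And>s::'s. open {s}" and T: "0 < T"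
  shows "path_on T (\<lambda>t \<omega>. g (X t \<omega>)) \<in> measurable P (borel_on (skorokhod_topology T))"
proof -
  interpret Sk: Metric_space "skorokhod_space T" "skorokhod_dist T"
    using Metric_space_skorokhod T by simp
  let ?x = "path_on T (\<lambda>t \<omega>. g (X t \<omega>))"
  define y where "y m \<omega> = (\<lambda>s\<in>{0..T}. g (X (grid_floor T m s) \<omega>))" for m \<omega>
  have x_in: "?x \<omega> \<in> skorokhod_space T" if "\<omega> \<in> space P" for \<omega>
    using path_on_in_skorokhod_space[where X = X and \<omega> = \<omega>, OF cadlag[OF that] discrete] T by simp
  have y_in: "y m \<omega> \<in> skorokhod_space T" if "0 < m" for m \<omega>
    unfolding y_def by (rule step_path_in_skorokhod_space[OF grid_floor_step_path[OF T that]])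
  have y_meas: "y m -` A \<inter> space P \<in> sets P" if m: "0 < m" for m A
  proof -
    define H where "H \<omega> = (\<lambda>i\<in>{..m}. X (T * real i / real m) \<omega>)" for \<omega>
    define F where "F f = (\<lambda>s\<in>{0..T}. g (f (nat \<lfloor>s * real m / T\<rfloor>)))" for f :: "nat \<Rightarrow> 's"
    have H: "H \<in> measurable P (count_space (PiE {..m} (\<lambda>_. S)))"
      unfolding H_def[abs_def] using T by (intro measurable_finite_history[OF S _ X]) auto
    have y: "y m \<omega> = F (H \<omega>)" for \<omega>
    proof -
      have "X (grid_floor T m s) \<omega> = H \<omega> (nat \<lfloor>s * real m / T\<rfloor>)" if s: "s \<in> {0..T}" for s
      proof -
        have "0 \<le> s * real m / T" "s * real m / T \<le> real m" using s T mult_right_mono[of s T "real m"] by (simp_all add: divide_le_eq mult.commute[of _ T])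
        then have "0 \<le> \<lfloor>s * real m / T\<rfloor>" "\<lfloor>s * real m / T\<rfloor> \<le> int m" by (auto simp: floor_le_iff)
        then show ?thesis by (simp add: H_def grid_floor_def nat_le_iff)
      qed
      then show ?thesis by (auto simp: y_def F_def fun_eq_iff restrict_def)
    qed
    have "y m -` A \<inter> space P = H -` ({f. F f \<in> A} \<inter> PiE {..m} (\<lambda>_. S)) \<inter> space P"
      using measurable_space[OF H] by (auto simp: y)
    also have "\<dots> \<in> sets P" by (rule measurable_sets[OF H]) simp
    finally show ?thesis .
  qed
  have conv: "\<exists>N>0. \<forall>m\<ge>N. skorokhod_dist T (?x \<omega>) (y m \<omega>) < e" if \<omega>: "\<omega> \<in> space P" and e: "0 < e" for \<omega> e
  proof -
    obtain J where J: "step_path T J (\<lambda>t. g (X t \<omega>))"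
      using cadlag_discrete_imp_step_path[OF cadlag[OF \<omega>] discrete] T step_path_compose[of T _ "\<lambda>t. X t \<omega>" g]
      by (meson less_imp_le)
    then obtain m0 where m0: "0 < m0" "\<And>m. m0 \<le> m \<Longrightarrow>
      skorokhod_close T (\<lambda>t. g (X t \<omega>)) (\<lambda>s. g (X (grid_floor T m s) \<omega>)) (real (card J) * (T / real m))"
      using step_path_grid_close[OF J T] by blast
    have cJ: "0 < card J" using J by (auto simp: step_path_def card_gt_0_iff)
    obtain m1 :: nat where m1: "real (card J) * T / e < real m1" using reals_Archimedean2 by blast
    have "skorokhod_dist T (?x \<omega>) (y m \<omega>) < e" if m: "max m0 (Suc m1) \<le> m" for m
    proof -
      have "skorokhod_dist T (?x \<omega>) (y m \<omega>) \<le> real (card J) * (T / real m)"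
      proof (rule skorokhod_dist_le[OF x_in[OF \<omega>] y_in])
        show "skorokhod_close T (?x \<omega>) (y m \<omega>) (real (card J) * (T / real m))"
          by (rule skorokhod_close_cong[OF _ _ m0(2)]) (use m in \<open>auto simp: path_on_def y_def\<close>)
        show "0 < real (card J) * (T / real m)" using cJ T m by simp
      qed (use m in simp)
      also have "\<dots> < e"
      proof -
        have "real m1 < real m" using m by simp
        with m1 have "real (card J) * T / e < real m" by linarith
        then show ?thesis using e m by (simp add: field_simps)
      qed
      finally show ?thesis .
    qed
    then show ?thesis using m0(1) by (intro exI[of _ "max m0 (Suc m1)"]) auto
  qed
  show ?thesis
    unfolding borel_on_def
  proof (rule measurable_measure_of)
    show "{U. openin (skorokhod_topology T) U} \<subseteq> Pow (topspace (skorokhod_topology T))"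
      using openin_subset by auto
    show "?x \<in> space P \<rightarrow> topspace (skorokhod_topology T)"
      using x_in by (auto simp: skorokhod_topology_def)
    fix U assume "U \<in> {U. openin (skorokhod_topology T) U}"
    then have U: "U \<subseteq> skorokhod_space T" "\<And>x. x \<in> U \<Longrightarrow> \<exists>r>0. Sk.mball x r \<subseteq> U"
      by (auto simp: skorokhod_topology_def Sk.openin_mtopology)
    define inner where "inner k = {x\<in>skorokhod_space T. Sk.mball x (1 / real (Suc k)) \<subseteq> U}" for k
    have "?x -` U \<inter> space P = (\<Union>k. \<Union>N. \<Inter>m\<in>{Suc N..}. y m -` inner k \<inter> space P)"
    proof (intro equalityI subsetI)
      fix \<omega> assume \<omega>: "\<omega> \<in> ?x -` U \<inter> space P"
      then obtain r where r: "0 < r" "Sk.mball (?x \<omega>) r \<subseteq> U" using U(2) by auto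
      obtain k where k: "1 / real (Suc k) < r / 2" using r(1) nat_approx_posE[of "r / 2"] by auto
      obtain N where N: "0 < N" "\<And>m. N \<le> m \<Longrightarrow> skorokhod_dist T (?x \<omega>) (y m \<omega>) < r / 2"
        using conv[of \<omega> "r / 2"] \<omega> r(1) by auto
      have "y m \<omega> \<in> inner k" if m: "Suc N \<le> m" for m
      proof -
        have "Sk.mball (y m \<omega>) (1 / real (Suc k)) \<subseteq> Sk.mball (?x \<omega>) r"
        proof
          fix v assume v: "v \<in> Sk.mball (y m \<omega>) (1 / real (Suc k))"
          then have "skorokhod_dist T (?x \<omega>) v \<le> skorokhod_dist T (?x \<omega>) (y m \<omega>) + skorokhod_dist T (y m \<omega>) v"
            using x_in \<omega> by (intro Sk.triangle) auto
          with v N(2)[of m] m k x_in \<omega> show "v \<in> Sk.mball (?x \<omega>) r" by auto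
        qed
        then show ?thesis using r(2) y_in m by (auto simp: inner_def)
      qed
      then show "\<omega> \<in> (\<Union>k. \<Union>N. \<Inter>m\<in>{Suc N..}. y m -` inner k \<inter> space P)" using \<omega> by blast
    next
      fix \<omega> assume "\<omega> \<in> (\<Union>k. \<Union>N. \<Inter>m\<in>{Suc N..}. y m -` inner k \<inter> space P)"
      then obtain k N where kN: "\<And>m. Suc N \<le> m \<Longrightarrow> \<omega> \<in> y m -` inner k \<inter> space P" by auto
      then have \<omega>: "\<omega> \<in> space P" by auto
      obtain N' where N': "\<And>m. N' \<le> m \<Longrightarrow> skorokhod_dist T (?x \<omega>) (y m \<omega>) < 1 / real (Suc k)"
        using conv[OF \<omega>, of "1 / real (Suc k)"] by auto
      define m where "m = max N' (Suc N)"
      have "?x \<omega> \<in> Sk.mball (y m \<omega>) (1 / real (Suc k))"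
        using N'[of m] x_in[OF \<omega>] y_in[of m \<omega>] by (auto simp: m_def Sk.commute)
      moreover have "Sk.mball (y m \<omega>) (1 / real (Suc k)) \<subseteq> U" using kN[of m] by (auto simp: m_def inner_def)
      ultimately show "\<omega> \<in> ?x -` U \<inter> space P" using \<omega> by auto
    qed
    also have "\<dots> \<in> sets P"
    proof -
      have "(\<Inter>m\<in>{Suc N..}. y m -` inner k \<inter> space P) \<in> sets P" for k N
        by (rule sets.countable_INT) (auto intro!: y_meas)
      then have "(\<Union>N. \<Inter>m\<in>{Suc N..}. y m -` inner k \<inter> space P) \<in> sets P" for k
        by (rule sets.countable_UN[OF image_subsetI])
      then show ?thesis by (rule sets.countable_UN[OF image_subsetI])
    qed
    finally show "?x -` U \<inter> space P \<in> sets P" .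
  qed
qed

lemma borel_measurable_continuous_map:
  assumes "continuous_map X euclideanreal f"
  shows "f \<in> borel_measurable (borel_on X)"
proof (rule borel_measurableI)
  fix S :: "real set" assume "open S"
  then have "openin X {x \<in> topspace X. f x \<in> S}"
    using assms by (auto intro: openin_continuous_map_preimage)
  moreover have "f -` S \<inter> space (borel_on X) = {x \<in> topspace X. f x \<in> S}"
    by (auto simp: borel_on_def space_measure_of_conv)
  moreover have "{U. openin X U} \<subseteq> Pow (topspace X)" using openin_subset by auto
  ultimately show "f -` S \<inter> space (borel_on X) \<in> sets (borel_on X)"
    by (auto simp: borel_on_def sets_measure_of)
qed

lemma skorokhod_dist_le_uniform:
  assumes "x \<in> skorokhod_space T" "y \<in> skorokhod_space T" "0 < e"
    and "\<And>t. t \<in> {0..T} \<Longrightarrow> \<bar>x t - y t\<bar> \<le> e"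
  shows "skorokhod_dist T x y \<le> e"
proof (rule skorokhod_dist_le[OF assms(1-3)])
  show "skorokhod_close T x y e"
    unfolding skorokhod_close_def using assms(3,4) by (intro bexI[OF _ id_time_change]) auto
qed

lemma continuous_in_skorokhod_space:
  assumes "continuous_on {0..T} z"
  shows "restrict z {0..T} \<in> skorokhod_space T"
proof -
  have "(restrict z {0..T} \<longlongrightarrow> restrict z {0..T} t) (at t within {0..T} \<inter> A)" if t: "t \<in> {0..T}" for t A
  proof (rule Lim_transform_eventually)
    have "(z \<longlongrightarrow> z t) (at t within {0..T} \<inter> A)"
      using assms t by (auto simp: continuous_on_def intro: tendsto_within_subset)
    then show "(z \<longlongrightarrow> restrict z {0..T} t) (at t within {0..T} \<inter> A)" using t by simp
    show "eventually (\<lambda>s. z s = restrict z {0..T} s) (at t within {0..T} \<inter> A)"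
      by (auto simp: eventually_at_filter)
  qed
  then have "cadlag_on {0..T} (restrict z {0..T})" unfolding cadlag_on_def by blast
  then show ?thesis by (simp add: skorokhod_space_def)
qed

text \<open>The Skorokhod distance is at most the uniform distance, so outside \<open>E n\<close> the path lies in a small ball
around \<open>z\<close>, on which a continuous \<open>f\<close> is nearly constant; the event \<open>E n\<close> contributes at most \<open>2 B\<close> times its
probability.  The sequence starts at index 1 because nothing is known about \<open>P 0\<close>.\<close>

lemma path_law_converges_to_constant:
  fixes P :: "nat \<Rightarrow> 'a measure" and X :: "nat \<Rightarrow> real \<Rightarrow> 'a \<Rightarrow> real"
  assumes T: "0 < T" and P: "\<And>n. 1 \<le> n \<Longrightarrow> prob_space (P n)"
    and meas: "\<And>n. 1 \<le> n \<Longrightarrow> path_on T (X n) \<in> measurable (P n) (borel_on (skorokhod_topology T))"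
    and z: "restrict z {0..T} \<in> skorokhod_space T"
    and unif: "\<And>e. 0 < e \<Longrightarrow> \<exists>E. (\<forall>n\<ge>1. E n \<in> sets (P n)) \<and> (\<lambda>n. measure (P n) (E n)) \<longlonglongrightarrow> 0 \<and>
       (\<forall>n\<ge>1. \<forall>\<omega>\<in>space (P n) - E n. \<forall>t\<in>{0..T}. \<bar>X n t \<omega> - z t\<bar> \<le> e)"
  shows "weak_convergence_on (skorokhod_topology T) (\<lambda>n. path_law T (P n) (X n))
           (return (borel_on (skorokhod_topology T)) (restrict z {0..T}))"
  unfolding weak_convergence_on_def
proof (intro allI impI)
  interpret Sk: Metric_space "skorokhod_space T" "skorokhod_dist T"
    using Metric_space_skorokhod T by simp
  let ?z = "restrict z {0..T}"
  have top: "topspace (skorokhod_topology T) = skorokhod_space T" by (simp add: skorokhod_topology_def)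
  have space: "space (borel_on (skorokhod_topology T)) = skorokhod_space T"
    by (simp add: borel_on_def space_measure_of_conv top)
  fix f :: "(real \<Rightarrow> real) \<Rightarrow> real"
  assume f: "continuous_map (skorokhod_topology T) euclideanreal f \<and> bounded (f ` topspace (skorokhod_topology T))"
  then have fm: "f \<in> borel_measurable (borel_on (skorokhod_topology T))"
    by (intro borel_measurable_continuous_map) simp
  obtain B where B: "0 < B" "\<And>x. x \<in> skorokhod_space T \<Longrightarrow> \<bar>f x\<bar> \<le> B"
    using f unfolding top bounded_pos by auto
  have law: "(\<integral>x. f x \<partial>path_law T (P n) (X n)) = (\<integral>\<omega>. f (path_on T (X n) \<omega>) \<partial>P n)" if "1 \<le> n" for n
    unfolding path_law_def using meas[OF that] fm by (rule integral_distr)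
  have "(\<lambda>n. \<integral>x. f x \<partial>path_law T (P n) (X n)) \<longlonglongrightarrow> f ?z"
  proof (rule LIMSEQ_I)
    fix d :: real assume d: "0 < d"
    have "openin (skorokhod_topology T) {x \<in> topspace (skorokhod_topology T). f x \<in> ball (f ?z) (d / 3)}"
      using f by (intro openin_continuous_map_preimage) auto
    then obtain r where r: "0 < r" "Sk.mball ?z r \<subseteq> {x \<in> skorokhod_space T. f x \<in> ball (f ?z) (d / 3)}"
      using z d unfolding top skorokhod_topology_def Sk.openin_mtopology by fastforce
    have "0 < r / 2" using r(1) by simp
    from unif[OF this] obtain E where E1: "\<forall>n\<ge>1. E n \<in> sets (P n)"
      and E2: "(\<lambda>n. measure (P n) (E n)) \<longlonglongrightarrow> 0"
      and E3: "\<forall>n\<ge>1. \<forall>\<omega>\<in>space (P n) - E n. \<forall>t\<in>{0..T}. \<bar>X n t \<omega> - z t\<bar> \<le> r / 2"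
      by blast
    have dB: "0 < d / (6 * B)" using d B(1) by simp
    obtain N where N: "\<And>n. N \<le> n \<Longrightarrow> measure (P n) (E n) < d / (6 * B)"
      using LIMSEQ_D[OF E2 dB] by (auto simp: measure_nonneg)
    have "norm ((\<integral>x. f x \<partial>path_law T (P n) (X n)) - f ?z) < d" if n: "max 1 N \<le> n" for n
    proof -
      have n1: "1 \<le> n" using n by simp
      interpret prob_space "P n" by (rule P[OF n1])
      have path: "path_on T (X n) \<omega> \<in> skorokhod_space T" if "\<omega> \<in> space (P n)" for \<omega>
        using measurable_space[OF meas[OF n1] that] space by simp
      have bound: "\<bar>f (path_on T (X n) \<omega>) - f ?z\<bar> \<le> d / 3 + 2 * B * indicator (E n) \<omega>" if \<omega>: "\<omega> \<in> space (P n)" for \<omega>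
      proof (cases "\<omega> \<in> E n")
        case True
        then show ?thesis using B(2)[OF path[OF \<omega>]] B(2)[OF z] d by simp
      next
        case False
        have "skorokhod_dist T ?z (path_on T (X n) \<omega>) \<le> r / 2"
          using E3 n1 \<omega> False r(1)
          by (intro skorokhod_dist_le_uniform z path \<omega>) (auto simp: path_on_def abs_minus_commute)
        then have "path_on T (X n) \<omega> \<in> Sk.mball ?z r"
          using z path[OF \<omega>] r(1) by (simp add: Sk.in_mball)
        then have "dist (f ?z) (f (path_on T (X n) \<omega>)) < d / 3" using r(2) by auto
        then show ?thesis using False by (simp add: dist_real_def abs_minus_commute)
      qed
      have fpm: "(\<lambda>\<omega>. f (path_on T (X n) \<omega>)) \<in> borel_measurable (P n)"
        by (rule measurable_compose[OF meas[OF n1] fm])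
      have i1: "integrable (P n) (\<lambda>\<omega>. f (path_on T (X n) \<omega>))"
        using B(2) path by (intro integrable_const_bound[where B = B] fpm) (auto intro!: AE_I2)
      have i2: "integrable (P n) (\<lambda>\<omega>. 2 * B * indicator (E n) \<omega>)"
        using E1 n1 by (auto simp: emeasure_finite less_top[symmetric])
      have "(\<integral>x. f x \<partial>path_law T (P n) (X n)) - f ?z = (\<integral>\<omega>. f (path_on T (X n) \<omega>) - f ?z \<partial>P n)"
        unfolding law[OF n1] using i1 by (simp add: prob_space)
      also have "\<bar>\<dots>\<bar> \<le> (\<integral>\<omega>. \<bar>f (path_on T (X n) \<omega>) - f ?z\<bar> \<partial>P n)"
        by (rule integral_abs_bound)
      also have "\<dots> \<le> (\<integral>\<omega>. d / 3 + 2 * B * indicator (E n) \<omega> \<partial>P n)"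
        using i1 i2 bound by (intro integral_mono) auto
      also have "\<dots> = d / 3 + 2 * B * measure (P n) (E n)"
        using i2 E1 n1 by (simp add: prob_space)
      also have "\<dots> < d"
      proof -
        have "2 * B * measure (P n) (E n) < d / 3"
          using N[of n] n B(1) by (simp add: field_simps)
        then show ?thesis using d by simp
      qed
      finally show ?thesis by simp
    qed
    then show "\<exists>N. \<forall>n\<ge>N. norm ((\<integral>x. f x \<partial>path_law T (P n) (X n)) - f ?z) < d"
      by (intro exI[of _ "max 1 N"] allI impI)
  qed
  moreover have "(\<integral>x. f x \<partial>return (borel_on (skorokhod_topology T)) ?z) = f ?z"
  proof (rule integral_return[OF _ fm])
    show "?z \<in> space (borel_on (skorokhod_topology T))" unfolding space by (rule z)
  qed
  ultimately show "(\<lambda>n. \<integral>x. f x \<partial>path_law T (P n) (X n)) \<longlonglongrightarrow> (\<integral>x. f x \<partial>return (borel_on (skorokhod_topology T)) ?z)"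
    by (simp only:)
qed

section \<open>Drift of the squared deviation from the fluid limit\<close>

lemma generator_apply:
  assumes S: "finite S" and i: "i \<in> S"
  shows "(\<Sum>j\<in>S. generator S r i j * f j) = (\<Sum>j\<in>S - {i}. r i j * (f j - f i))"
proof -
  have "(\<Sum>j\<in>S. generator S r i j * f j)
      = generator S r i i * f i + (\<Sum>j\<in>S - {i}. generator S r i j * f j)"
    using S i by (rule sum.remove)
  also have "(\<Sum>j\<in>S - {i}. generator S r i j * f j) = (\<Sum>j\<in>S - {i}. r i j * f j)"
    by (intro sum.cong) (auto simp: generator_def)
  also have "generator S r i i * f i = - (\<Sum>j\<in>S - {i}. r i j * f i)"
    by (simp add: generator_def sum_distrib_right)
  finally show ?thesis by (simp add: right_diff_distrib sum_subtractf)
qed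

lemma finite_station_states: "finite (station_states K)"
  by (rule finite_subset[of _ "{..K} \<times> {..K}"]) (auto simp: station_states_def)

text \<open>At \<open>z = 0\<close> or \<open>q = 0\<close> the truncated differences name a wrong target, but then the rate in front is \<open>0\<close>;
the condition on \<open>M\<close> is what makes the charging rate vanish at \<open>z = 0\<close>.\<close>

lemma station_generator:
  fixes f :: "nat \<times> nat \<Rightarrow> real"
  assumes i: "(q, z) \<in> station_states K" and M: "0 \<le> M"
  shows "(\<Sum>j\<in>station_states K. generator (station_states K) (station_rate lam K M mu nu) (q, z) j * f j)
    = (if q < K then lam * (f (q + 1, z + 1) - f (q, z)) else 0)
      + mu * min (real z) M * (f (q, z - 1) - f (q, z))
      + nu * real z * (f (q - 1, z - 1) - f (q, z))
      + nu * (real q - real z) * (f (q - 1, z) - f (q, z))"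
    (is "_ = ?arr + ?chg + ?dep1 + ?dep2")
proof -
  let ?A = "station_states K - {(q, z)}"
  have zq: "z \<le> q" "q \<le> K" using i by (auto simp: station_states_def)
  have fin: "finite ?A" using finite_station_states by simp
  have m0: "min 0 M = 0" using M by simp
  have "(\<Sum>j\<in>station_states K. generator (station_states K) (station_rate lam K M mu nu) (q, z) j * f j)
      = (\<Sum>j\<in>?A. station_rate lam K M mu nu (q, z) j * (f j - f (q, z)))"
    by (rule generator_apply[OF finite_station_states i])
  also have "\<dots> = (\<Sum>j\<in>?A. (if j = (q + 1, z + 1) then ?arr else 0) + (if j = (q, z - 1) then ?chg else 0)
      + (if j = (q - 1, z - 1) then ?dep1 else 0) + (if j = (q - 1, z) then ?dep2 else 0))"
  proof (intro sum.cong refl)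
    fix j assume j: "j \<in> ?A"
    obtain q' z' where [simp]: "j = (q', z')" by (cases j)
    show "station_rate lam K M mu nu (q, z) j * (f j - f (q, z))
        = (if j = (q + 1, z + 1) then ?arr else 0) + (if j = (q, z - 1) then ?chg else 0)
          + (if j = (q - 1, z - 1) then ?dep1 else 0) + (if j = (q - 1, z) then ?dep2 else 0)"
    proof (cases "z = 0")
      case True
      then show ?thesis using j zq m0 by (cases q) (auto simp: station_states_def)
    next
      case False
      then obtain z1 q1 where "z = Suc z1" "q = Suc q1" using zq by (metis not0_implies_Suc le_zero_eq)
      then show ?thesis using j zq by (auto simp: station_states_def)
    qed
  qed
  also have "\<dots> = (if (q + 1, z + 1) \<in> ?A then ?arr else 0) + (if (q, z - 1) \<in> ?A then ?chg else 0)
      + (if (q - 1, z - 1) \<in> ?A then ?dep1 else 0) + (if (q - 1, z) \<in> ?A then ?dep2 else 0)"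
    using fin by (simp only: sum.distrib sum.delta)
  also have "\<dots> = ?arr + ?chg + ?dep1 + ?dep2"
    using zq m0 by (cases "z = 0"; cases "q = 0"; cases "q = z") (auto simp: station_states_def)
  finally show ?thesis .
qed

lemma open_singleton_nat_pair: "open {s :: nat \<times> nat}"
proof -
  have "open ({fst s} \<times> {snd s})"
    by (intro open_Times discrete_topology_class.open_discrete)
  then show ?thesis by simp
qed

text \<open>The second coordinate is the scaled number \<open>q - z\<close> of fully charged cars and not \<open>z\<close> itself: arriving cars
are uncharged, so \<open>q - z\<close> does not feel whether an arrival is admitted or blocked.\<close>

definition deviation :: "nat \<Rightarrow> real \<Rightarrow> real \<Rightarrow> nat \<times> nat \<Rightarrow> real" where
  "deviation n \<xi> w = (\<lambda>(q, z). (real q / n - \<xi>)\<^sup>2 + ((real q - real z) / n - w)\<^sup>2)"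

text \<open>A jump of size \<open>1 / n\<close> changes the square of a coordinate by twice the deviation times the jump, plus
\<open>1 / n\<^sup>2\<close>.  As the rates are of order \<open>n\<close>, the first part gives the fluid drift and the second one a noise
term of order \<open>1 / n\<close>.\<close>

lemma station_generator_deviation:
  fixes n K :: nat and lam mu nu M \<xi> w :: real
  assumes n: "0 < n" and i: "(q, z) \<in> station_states (n * K)" and M: "0 \<le> M"
  defines "x \<equiv> real q / n" and "v \<equiv> (real q - real z) / n"
  shows "(\<Sum>j\<in>station_states (n * K). generator (station_states (n * K))
            (station_rate (real n * lam) (n * K) (real n * M) mu nu) (q, z) j * deviation n \<xi> w j)
    = 2 * (x - \<xi>) * ((if q < n * K then lam else 0) - nu * x)
      + 2 * (v - w) * (mu * min (real z / n) M - nu * v)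
      + ((if q < n * K then lam else 0) + mu * min (real z / n) M + nu * x + nu * v) / n"
proof -
  have zq: "z \<le> q" using i by (auto simp: station_states_def)
  have minn: "min (real z) (real n * M) = n * min (real z / n) M"
    using n by (simp add: min_mult_distrib_left)
  let ?f = "deviation n \<xi> w"
  have arr: "?f (q + 1, z + 1) - ?f (q, z) = 2 * (x - \<xi>) / n + 1 / n\<^sup>2"
    using n by (simp add: deviation_def x_def field_simps power2_eq_square)
  have chg: "min (real z) (real n * M) * (?f (q, z - 1) - ?f (q, z))
      = n * min (real z / n) M * (2 * (v - w) / n + 1 / n\<^sup>2)"
  proof (cases "z = 0")
    case True
    then show ?thesis using M by simp
  next
    case False
    then have "real (z - 1) = real z - 1" by simp
    then have "?f (q, z - 1) - ?f (q, z) = 2 * (v - w) / n + 1 / n\<^sup>2"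
      using n by (simp add: deviation_def v_def field_simps power2_eq_square)
    then show ?thesis by (simp only: minn)
  qed
  have dep1: "real z * (?f (q - 1, z - 1) - ?f (q, z)) = real z * (- 2 * (x - \<xi>) / n + 1 / n\<^sup>2)"
  proof (cases "z = 0")
    case False
    then have "real (z - 1) = real z - 1" "real (q - 1) = real q - 1" using zq by auto
    then show ?thesis
      using n by (simp add: deviation_def x_def field_simps power2_eq_square)
  qed simp
  have dep2: "(real q - real z) * (?f (q - 1, z) - ?f (q, z))
      = (real q - real z) * (- 2 * (x - \<xi>) / n - 2 * (v - w) / n + 2 / n\<^sup>2)"
  proof (cases "q = z")
    case False
    then have "real (q - 1) = real q - 1" using zq by auto
    then have "?f (q - 1, z) - ?f (q, z) = - 2 * (x - \<xi>) / n - 2 * (v - w) / n + 2 / n\<^sup>2"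
      using n by (simp add: deviation_def x_def v_def field_simps power2_eq_square)
    then show ?thesis by (simp only:)
  qed simp
  have zn: "real z = n * (x - v)" and qzn: "real q - real z = n * v"
    using n by (simp_all add: x_def v_def field_simps)
  define m where "m = min (real z / n) M"
  define l where "l = (if q < n * K then lam else 0)"
  have "(\<Sum>j\<in>station_states (n * K). generator (station_states (n * K))
            (station_rate (real n * lam) (n * K) (real n * M) mu nu) (q, z) j * ?f j)
      = real n * l * (?f (q + 1, z + 1) - ?f (q, z))
        + mu * (min (real z) (real n * M) * (?f (q, z - 1) - ?f (q, z)))
        + nu * (real z * (?f (q - 1, z - 1) - ?f (q, z)))
        + nu * ((real q - real z) * (?f (q - 1, z) - ?f (q, z)))"
    using n M by (subst station_generator[OF i]) (simp_all add: l_def mult.assoc)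
  also have "\<dots> = real n * l * (2 * (x - \<xi>) / n + 1 / n\<^sup>2) + mu * (n * m * (2 * (v - w) / n + 1 / n\<^sup>2))
        + nu * (n * (x - v) * (- 2 * (x - \<xi>) / n + 1 / n\<^sup>2))
        + nu * (n * v * (- 2 * (x - \<xi>) / n - 2 * (v - w) / n + 2 / n\<^sup>2))"
    unfolding arr chg dep1 dep2 unfolding qzn m_def[symmetric] unfolding zn ..
  also have "\<dots> = 2 * (x - \<xi>) * (l - nu * x) + 2 * (v - w) * (mu * m - nu * v) + (l + mu * m + nu * x + nu * v) / n"
    using n by (simp add: field_simps power2_eq_square)
  finally show ?thesis unfolding m_def l_def .
qed

lemma power2_diff_le: "(a - b)\<^sup>2 \<le> 2 * a\<^sup>2 + 2 * b\<^sup>2" for a b :: real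
  using zero_le_power2[of "a + b"] by (simp add: power2_diff power2_sum)

lemma lipschitz_min_product_bound:
  fixes a b :: real
  shows "2 * b * (min (y + (a - b)) M - min y M) \<le> 3 * (a\<^sup>2 + b\<^sup>2)"
proof -
  have "\<bar>min (y + (a - b)) M - min y M\<bar> \<le> \<bar>a\<bar> + \<bar>b\<bar>" by linarith
  then have "\<bar>2 * b * (min (y + (a - b)) M - min y M)\<bar> \<le> 2 * \<bar>b\<bar> * (\<bar>a\<bar> + \<bar>b\<bar>)"
    unfolding abs_mult by (intro mult_mono) auto
  moreover have "2 * \<bar>b\<bar> * \<bar>a\<bar> \<le> a\<^sup>2 + b\<^sup>2"
    using zero_le_power2[of "\<bar>a\<bar> - \<bar>b\<bar>"] by (simp add: power2_diff mult_ac)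
  moreover have "2 * \<bar>b\<bar> * \<bar>b\<bar> = 2 * b\<^sup>2" by (simp add: power2_eq_square)
  moreover have "0 \<le> a\<^sup>2" by simp
  ultimately show ?thesis unfolding distrib_left by (smt (verit))
qed

text \<open>The boundary enters only through the occupancy \<open>x = q / n\<close>, and it always pushes in the right direction.
If \<open>lam < nu K\<close>, the admission rate agrees with \<open>lam\<close> unless the station is full, and then \<open>x = K \<ge> \<xi>\<close> while
the rate drops to \<open>0\<close>.  If \<open>nu K \<le> lam\<close>, then \<open>\<xi> = K\<close>, so \<open>x \<le> \<xi>\<close>, and below \<open>K\<close> the admission rate \<open>lam\<close> is at
least \<open>nu K\<close>.  The coordinate \<open>q - z\<close> is driven
by a Lipschitz function of both coordinates, which gives the factor \<open>3 mu\<close>.\<close>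

lemma station_deviation_drift:
  fixes n K :: nat and lam mu nu M \<xi> z :: real
  assumes n: "0 < n" and i: "(qs, zs) \<in> station_states (n * K)"
    and par: "0 < lam" "0 < mu" "0 < nu" "0 < M" "M \<le> K"
    and \<xi>: "\<xi> \<le> K" "nu * K \<le> lam \<Longrightarrow> \<xi> = K"
  shows "- 2 * (real qs / n - \<xi>) * (min lam (nu * K) - nu * \<xi>)
      - 2 * ((real qs - real zs) / n - (\<xi> - z)) * (mu * min z M - nu * (\<xi> - z))
      + (\<Sum>j\<in>station_states (n * K). generator (station_states (n * K))
            (station_rate (real n * lam) (n * K) (real n * M) mu nu) (qs, zs) j * deviation n \<xi> (\<xi> - z) j)
    \<le> 3 * mu * deviation n \<xi> (\<xi> - z) (qs, zs) + (lam + mu * K + 2 * nu * K) / n"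
proof -
  define x where "x = real qs / n"
  define v where "v = (real qs - real zs) / n"
  define m where "m = min (real zs / n) M"
  define l where "l = (if qs < n * K then lam else 0)"
  define a where "a = x - \<xi>"
  define b where "b = v - (\<xi> - z)"
  have zq: "zs \<le> qs" "qs \<le> n * K" using i by (auto simp: station_states_def)
  have zn: "real zs / n = z + (a - b)"
    using n by (simp add: a_def b_def x_def v_def field_simps)
  have xK: "0 \<le> x" "x \<le> K" "0 \<le> v" "v \<le> K"
  proof -
    have q: "real qs \<le> real n * real K" using zq(2) by (metis of_nat_le_iff of_nat_mult)
    then show "0 \<le> x" "x \<le> K" "0 \<le> v" "v \<le> K"
      using n zq(1) by (auto simp: x_def v_def divide_le_eq mult.commute)
  qed
  have admission: "a * (l - min lam (nu * K)) \<le> 0"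
  proof (cases "qs < n * K")
    case True
    then have l: "l = lam" by (simp add: l_def)
    show ?thesis
    proof (cases "nu * K \<le> lam")
      case True
      then have "a \<le> 0" using \<xi>(2) xK(2) by (simp add: a_def)
      then show ?thesis using l True by (simp add: min_def mult_nonpos_nonneg)
    next
      case False
      then show ?thesis using l by (simp add: min_def)
    qed
  next
    case False
    then have "qs = n * K" using zq by simp
    then have "x = K" using n by (simp add: x_def)
    then have "0 \<le> a" using \<xi>(1) by (simp add: a_def)
    then show ?thesis using False par by (simp add: l_def mult_nonneg_nonpos)
  qed
  have noise: "l + mu * m + nu * x + nu * v \<le> lam + mu * K + 2 * nu * K"
  proof -
    have "l \<le> lam" using par by (simp add: l_def)
    moreover have "mu * m \<le> mu * K" using par by (simp add: m_def)
    moreover have "nu * x \<le> nu * K" "nu * v \<le> nu * K" using par xK by simp_all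
    ultimately show ?thesis by linarith
  qed
  have lips: "mu * (2 * b * (m - min z M)) \<le> mu * (3 * (a\<^sup>2 + b\<^sup>2))"
    using lipschitz_min_product_bound[of b z a M] par unfolding m_def zn by (intro mult_left_mono) auto
  have "- 2 * a * (min lam (nu * K) - nu * \<xi>) - 2 * b * (mu * min z M - nu * (\<xi> - z))
      + (2 * a * (l - nu * x) + 2 * b * (mu * m - nu * v) + (l + mu * m + nu * x + nu * v) / n)
      = 2 * (a * (l - min lam (nu * K))) - 2 * nu * a\<^sup>2 + mu * (2 * b * (m - min z M)) - 2 * nu * b\<^sup>2
        + (l + mu * m + nu * x + nu * v) / n"
    unfolding a_def b_def by (simp add: algebra_simps power2_eq_square)
  also have "\<dots> \<le> 2 * 0 - 0 + mu * (3 * (a\<^sup>2 + b\<^sup>2)) - 0 + (lam + mu * K + 2 * nu * K) / n"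
  proof -
    have "(l + mu * m + nu * x + nu * v) / n \<le> (lam + mu * K + 2 * nu * K) / n"
      using noise by (rule divide_right_mono) simp
    moreover have "0 \<le> 2 * nu * a\<^sup>2" "0 \<le> 2 * nu * b\<^sup>2" using par by simp_all
    ultimately show ?thesis using admission lips by linarith
  qed
  also have "\<dots> = 3 * mu * deviation n \<xi> (\<xi> - z) (qs, zs) + (lam + mu * K + 2 * nu * K) / n"
    by (simp add: deviation_def a_def b_def x_def v_def)
  finally show ?thesis
    unfolding station_generator_deviation[OF n i less_imp_le[OF par(4)]]
    unfolding x_def[symmetric] v_def[symmetric] m_def[symmetric] l_def[symmetric]
      a_def[symmetric] b_def[symmetric] .
qed

text \<open>The discounted deviation plus the noise still to come, \<open>exp (- 3 mu t) U t + R (T - t)\<close>, is a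
nonnegative supersolution, so the maximal inequality applies.  The level is chosen such that, even with
the smallest discount factor \<open>exp (- 3 mu T)\<close>, staying below it forces \<open>U t \<le> e\<^sup>2 / 2\<close>; the error
\<open>Z / n - z\<close> is the difference of the two coordinate errors and hence at most \<open>e\<close>.\<close>

lemma station_deviation_maximal_inequality:
  fixes n K :: nat and lam mu nu M T e :: real and \<xi> z :: "real \<Rightarrow> real"
  assumes n: "0 < n" and par: "0 < lam" "0 < mu" "0 < nu" "0 < M" "M \<le> K" and T: "0 < T" and e: "0 < e"
    and station: "charging_station_process (real n * lam) (n * K) (real n * M) mu nu P Q Z"
    and \<xi>: "\<And>t. 0 \<le> t \<Longrightarrow> (\<xi> has_real_derivative (min lam (nu * K) - nu * \<xi> t)) (at t)"
      "\<And>t. 0 \<le> t \<Longrightarrow> \<xi> t \<le> K" "\<And>t. nu * K \<le> lam \<Longrightarrow> \<xi> t = K"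
    and z: "\<And>t. 0 \<le> t \<Longrightarrow> (z has_real_derivative (min lam (nu * K) - nu * z t - mu * min (z t) M)) (at t)"
  obtains E where "E \<in> sets P"
    "e\<^sup>2 / 2 * exp (- 3 * mu * T) * measure P E
      \<le> (\<integral>\<omega>. deviation n (\<xi> 0) (\<xi> 0 - z 0) (Q 0 \<omega>, Z 0 \<omega>) \<partial>P) + (lam + mu * K + 2 * nu * K) * T / n"
    "\<And>\<omega> t. \<omega> \<in> space P \<Longrightarrow> \<omega> \<notin> E \<Longrightarrow> t \<in> {0..T} \<Longrightarrow> \<bar>real (Z t \<omega>) / n - z t\<bar> \<le> e"
proof -
  let ?S = "station_states (n * K)"
  let ?r = "station_rate (real n * lam) (n * K) (real n * M) mu nu"
  define R where "R = (lam + mu * K + 2 * nu * K) / n"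
  have R: "0 \<le> R" using par by (simp add: R_def)
  define U where "U t = deviation n (\<xi> t) (\<xi> t - z t)" for t
  define U' where "U' t = (\<lambda>(q, s). - 2 * (real q / n - \<xi> t) * (min lam (nu * K) - nu * \<xi> t)
      - 2 * ((real q - real s) / n - (\<xi> t - z t)) * (mu * min (z t) M - nu * (\<xi> t - z t)))" for t
  define V where "V t j = exp (- 3 * mu * t) * U t j + R * (T - t)" for t j
  define V' where "V' t j = exp (- 3 * mu * t) * (U' t j - 3 * mu * U t j) - R" for t j
  have chain: "finite_ctmc ?S ?r P (\<lambda>t \<omega>. (Q t \<omega>, Z t \<omega>))"
    using station by (simp add: charging_station_process_def)
  have U0: "0 \<le> U t j" for t j by (simp add: U_def deviation_def split: prod.split)
  have dU: "((\<lambda>t. U t j) has_real_derivative U' t j) (at t)" if t: "0 \<le> t" for t j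
  proof -
    obtain q s where j: "j = (q, s)" by (cases j)
    have "((\<lambda>t. \<xi> t - z t) has_real_derivative (mu * min (z t) M - nu * (\<xi> t - z t))) (at t)"
      by (rule derivative_eq_intros \<xi>(1)[OF t] z[OF t] refl)+ (simp add: algebra_simps)
    moreover have "((\<lambda>t. (b - f t)\<^sup>2) has_real_derivative - 2 * (b - f t) * f') (at t)"
      if "(f has_real_derivative f') (at t)" for b f' and f :: "real \<Rightarrow> real"
      by (rule derivative_eq_intros that refl)+ (simp add: algebra_simps)
    ultimately have "((\<lambda>t. (real q / n - \<xi> t)\<^sup>2 + ((real q - real s) / n - (\<xi> t - z t))\<^sup>2) has_real_derivative
        - 2 * (real q / n - \<xi> t) * (min lam (nu * K) - nu * \<xi> t)
        + - 2 * ((real q - real s) / n - (\<xi> t - z t)) * (mu * min (z t) M - nu * (\<xi> t - z t))) (at t)"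
      using \<xi>(1)[OF t] by (intro DERIV_add)
    then show ?thesis
      unfolding U_def U'_def j deviation_def prod.case
      by (rule DERIV_cong) (simp only: mult_minus_left add_uminus_conv_diff)
  qed
  have dV: "((\<lambda>t. V t j) has_real_derivative V' t j) (at t)" if t: "0 \<le> t" for t j
    unfolding V_def V'_def
    by (rule derivative_eq_intros dU[OF t] refl)+ (simp add: algebra_simps)
  have gen: "(\<Sum>j\<in>?S. generator ?S ?r i j * V t j) = exp (- 3 * mu * t) * (\<Sum>j\<in>?S. generator ?S ?r i j * U t j)"
    if i: "i \<in> ?S" for t i
    unfolding generator_apply[OF finite_station_states i] sum_distrib_left V_def
    by (intro sum.cong refl) (simp add: algebra_simps)
  have super: "V' t i + (\<Sum>j\<in>?S. generator ?S ?r i j * V t j) \<le> 0"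
    if t: "0 \<le> t" and i: "i \<in> ?S" for t i
  proof -
    obtain q s where qs: "i = (q, s)" by (cases i)
    have "U' t i + (\<Sum>j\<in>?S. generator ?S ?r i j * U t j) \<le> 3 * mu * U t i + R"
      using station_deviation_drift[OF n i[unfolded qs] par \<xi>(2)[OF t] \<xi>(3)[of t], of "z t"]
      unfolding qs U_def U'_def R_def prod.case .
    then have "exp (- 3 * mu * t) * (U' t i - 3 * mu * U t i + (\<Sum>j\<in>?S. generator ?S ?r i j * U t j))
        \<le> exp (- 3 * mu * t) * R"
      by (intro mult_left_mono) auto
    also have "\<dots> \<le> R" using R par t by (intro mult_left_le_one_le) auto
    finally show ?thesis unfolding gen[OF i] V'_def by (simp add: algebra_simps)
  qed
  have V0: "0 \<le> V t j" if "t \<le> T" for t j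
    using U0 R that by (simp add: V_def)
  let ?a = "e\<^sup>2 / 2 * exp (- 3 * mu * T)"
  obtain E where E: "E \<in> sets P" "?a * measure P E \<le> (\<integral>\<omega>. V 0 (Q 0 \<omega>, Z 0 \<omega>) \<partial>P)"
    "\<And>\<omega> t. \<omega> \<in> space P \<Longrightarrow> \<omega> \<notin> E \<Longrightarrow> t \<in> {0..T} \<Longrightarrow> V t (Q t \<omega>, Z t \<omega>) \<le> ?a"
  proof (rule ctmc_maximal_inequality[where V = V and V' = V' and T = T and a = ?a, OF chain])
    show "open {s}" for s :: "nat \<times> nat" by (rule open_singleton_nat_pair)
  qed (use T e dV V0 super in auto)
  have "(\<integral>\<omega>. V 0 (Q 0 \<omega>, Z 0 \<omega>) \<partial>P) = (\<integral>\<omega>. deviation n (\<xi> 0) (\<xi> 0 - z 0) (Q 0 \<omega>, Z 0 \<omega>) \<partial>P) + R * T"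
  proof -
    interpret prob_space P using chain by (simp add: finite_ctmc_def)
    have "(\<lambda>\<omega>. (Q 0 \<omega>, Z 0 \<omega>)) \<in> measurable P (count_space ?S)" using chain by (simp add: finite_ctmc_def)
    from integrable_finite_valued[OF finite_station_states this, of "U 0"]
    show ?thesis by (simp add: V_def U_def prob_space)
  qed
  moreover have "\<bar>real (Z t \<omega>) / n - z t\<bar> \<le> e" if \<omega>: "\<omega> \<in> space P" "\<omega> \<notin> E" and t: "t \<in> {0..T}" for \<omega> t
  proof -
    let ?x = "real (Q t \<omega>) / n - \<xi> t" and ?v = "(real (Q t \<omega>) - real (Z t \<omega>)) / n - (\<xi> t - z t)"
    have "exp (- 3 * mu * T) * U t (Q t \<omega>, Z t \<omega>) \<le> exp (- 3 * mu * t) * U t (Q t \<omega>, Z t \<omega>)"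
      using t par U0 by (intro mult_right_mono) auto
    also have "\<dots> \<le> V t (Q t \<omega>, Z t \<omega>)" using R t by (simp add: V_def)
    also have "\<dots> \<le> ?a" by (rule E(3)[OF \<omega> t])
    finally have "U t (Q t \<omega>, Z t \<omega>) \<le> e\<^sup>2 / 2" by (simp add: mult.commute[of "exp _"])
    then have "?x\<^sup>2 + ?v\<^sup>2 \<le> e\<^sup>2 / 2" by (simp add: U_def deviation_def)
    moreover have "a\<^sup>2 + b\<^sup>2 \<le> e\<^sup>2 / 2 \<Longrightarrow> (a - b)\<^sup>2 \<le> e\<^sup>2" for a b
      using power2_diff_le[of a b] by simp
    ultimately have "(?x - ?v)\<^sup>2 \<le> e\<^sup>2" by blast
    moreover have "real (Z t \<omega>) / n - z t = ?x - ?v" by (simp add: diff_divide_distrib)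
    ultimately have "(real (Z t \<omega>) / n - z t)\<^sup>2 \<le> e\<^sup>2" by (simp only:)
    then show ?thesis using e by (simp add: abs_le_square_iff[symmetric])
  qed
  ultimately show ?thesis using E(1,2) that by (simp add: R_def)
qed

section \<open>Convergence to the fluid limit\<close>

text \<open>Since \<open>Y n\<close> and \<open>c\<close> lie in \<open>[0, b]\<close>, the square may be truncated to a bounded continuous test function.  The
sequence is shifted by one because \<open>P 0\<close> need not be a probability space.\<close>

lemma weak_conv_const_imp_second_moment:
  fixes Y :: "nat \<Rightarrow> 'a \<Rightarrow> real"
  assumes P: "\<And>n. 1 \<le> n \<Longrightarrow> prob_space (P n)"
    and Y: "\<And>n. 1 \<le> n \<Longrightarrow> Y n \<in> borel_measurable (P n)"
    and bound: "\<And>n \<omega>. 1 \<le> n \<Longrightarrow> \<omega> \<in> space (P n) \<Longrightarrow> 0 \<le> Y n \<omega> \<and> Y n \<omega> \<le> b"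
    and c: "0 \<le> c" "c \<le> b"
    and conv: "weak_conv_m (\<lambda>n. distr (P n) borel (Y n)) (return borel c)"
  shows "(\<lambda>n. \<integral>\<omega>. (Y n \<omega> - c)\<^sup>2 \<partial>P n) \<longlonglongrightarrow> 0"
proof -
  define f where "f u = (max 0 (min u b) - c)\<^sup>2" for u :: real
  have fm: "f \<in> borel_measurable borel" unfolding f_def[abs_def] by measurable
  have "(\<lambda>n. \<integral>u. f u \<partial>distr (P (Suc n)) borel (Y (Suc n))) \<longlonglongrightarrow> (\<integral>u. f u \<partial>return borel c)"
  proof (rule weak_conv_imp_integral_bdd_continuous_conv[where B = "b\<^sup>2"])
    show "real_distribution (distr (P (Suc n)) borel (Y (Suc n)))" for n
      using P[of "Suc n"] Y[of "Suc n"] by (simp add: prob_space.real_distribution_distr)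
    show "real_distribution (return borel c)"
      by (intro real_distribution.intro prob_space_return real_distribution_axioms.intro) simp_all
    show "weak_conv_m (\<lambda>n. distr (P (Suc n)) borel (Y (Suc n))) (return borel c)"
      using conv unfolding weak_conv_m_def weak_conv_def by (auto intro: LIMSEQ_Suc)
    show "isCont f u" for u unfolding f_def by (intro continuous_intros)
    show "norm (f u) \<le> b\<^sup>2" for u
    proof -
      have "\<bar>max 0 (min u b) - c\<bar> \<le> \<bar>b\<bar>" using c by linarith
      then show ?thesis by (simp add: f_def abs_le_square_iff)
    qed
  qed
  moreover have "(\<integral>u. f u \<partial>return borel c) = 0"
    using c fm by (subst integral_return) (auto simp: f_def)
  moreover have "(\<integral>u. f u \<partial>distr (P (Suc n)) borel (Y (Suc n))) = (\<integral>\<omega>. (Y (Suc n) \<omega> - c)\<^sup>2 \<partial>P (Suc n))" for n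
  proof -
    have "(\<integral>u. f u \<partial>distr (P (Suc n)) borel (Y (Suc n))) = (\<integral>\<omega>. f (Y (Suc n) \<omega>) \<partial>P (Suc n))"
      using Y[of "Suc n"] fm by (intro integral_distr) auto
    also have "\<dots> = (\<integral>\<omega>. (Y (Suc n) \<omega> - c)\<^sup>2 \<partial>P (Suc n))"
      using bound[of "Suc n"] by (intro Bochner_Integration.integral_cong) (auto simp: f_def max_def min_def)
    finally show ?thesis .
  qed
  ultimately have "(\<lambda>n. \<integral>\<omega>. (Y (Suc n) \<omega> - c)\<^sup>2 \<partial>P (Suc n)) \<longlonglongrightarrow> 0" by simp
  then show ?thesis by (rule LIMSEQ_imp_Suc)
qed

theorem proposition4p1:
  fixes lam mu nu M z0 :: real and K :: nat
    and P :: "nat \<Rightarrow> 'a measure"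
    and Q Z :: "nat \<Rightarrow> real \<Rightarrow> 'a \<Rightarrow> nat"
  assumes "0 < lam" and "0 < mu" and "0 < nu"
    and "0 < K" and "0 < M" and "M \<le> real K"
    and "\<And>n. n \<ge> 1 \<Longrightarrow>
          charging_station_process (real n * lam) (n * K) (real n * M) mu nu (P n) (Q n) (Z n)"
    and "z0 \<in> {0..real K}"
    and "weak_conv_m (\<lambda>n. distr (P n) borel (\<lambda>\<omega>. real (Z n 0 \<omega>) / real n)) (return borel z0)"
    and "weak_conv_m (\<lambda>n. distr (P n) borel (\<lambda>\<omega>. real (Q n 0 \<omega>) / real n)) (return borel (real K))"
  shows "\<exists>z :: real \<Rightarrow> real.
           continuous_on {0..} z \<and>
           (\<forall>t\<ge>0. z t \<in> {0..real K}) \<and>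
           z 0 = z0 \<and>
           (\<forall>t\<ge>0. (z has_real_derivative
                     (min lam (nu * real K) - nu * z t - mu * min (z t) M)) (at t within {0..})) \<and>
           process_conv_in_dist P (\<lambda>n t \<omega>. real (Z n t \<omega>) / real n) z"
proof -
  note station = assms(7)
  define c where "c = min lam (nu * K)"
  have c: "0 \<le> c" "c \<le> nu * K" using assms by (auto simp: c_def)
  obtain z where z0: "z 0 = z0" and z_range: "\<And>t. 0 \<le> t \<Longrightarrow> 0 \<le> z t" "\<And>t. 0 \<le> t \<Longrightarrow> z t \<le> K"
    and z: "\<And>t. 0 \<le> t \<Longrightarrow> (z has_real_derivative (c - nu * z t - mu * min (z t) M)) (at t)"
    using fluid_ode_solution[of mu nu M "real K" c z0] assms c by auto
  \<comment> \<open>The fluid limit of \<open>Q / n\<close>.  If \<open>nu K \<le> lam\<close>, then \<open>c / nu = K\<close> and \<open>\<xi>\<close> is constant.\<close>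
  define \<xi> where "\<xi> t = c / nu + (real K - c / nu) * exp (- nu * t)" for t
  have \<xi>: "(\<xi> has_real_derivative (c - nu * \<xi> t)) (at t)" for t
  proof -
    have "c - nu * \<xi> t = nu * (c / nu - \<xi> t)" using assms(3) by (simp add: right_diff_distrib)
    then show ?thesis
      unfolding \<xi>_def using exponential_relaxation_deriv[of "c / nu" K nu t UNIV] by simp
  qed
  have \<xi>K: "\<xi> t \<le> K" if "0 \<le> t" for t
  proof -
    have "c / nu \<le> K" using c(2) assms(3) by (simp add: divide_le_eq mult.commute)
    then show ?thesis
      unfolding \<xi>_def using exponential_relaxation_between(2)[OF less_imp_le[OF assms(3)] that, of "c / nu" "real K"]
      by (simp only: max_absorb1)
  qed
  have \<xi>_sat: "\<xi> t = K" if "nu * K \<le> lam" for t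
    using that assms(3) by (simp add: \<xi>_def c_def)
  have \<xi>0: "\<xi> 0 = K" by (simp add: \<xi>_def)
  have cont: "continuous_on {0..} z"
    using z by (intro continuous_at_imp_continuous_on) (auto intro: DERIV_isCont)
  have P: "prob_space (P n)"
    and X: "\<And>t. 0 \<le> t \<Longrightarrow> (\<lambda>\<omega>. (Q n t \<omega>, Z n t \<omega>)) \<in> measurable (P n) (count_space (station_states (n * K)))"
    and cadlag: "\<And>\<omega>. \<omega> \<in> space (P n) \<Longrightarrow> cadlag_on {0..} (\<lambda>t. (Q n t \<omega>, Z n t \<omega>))" if "1 \<le> n" for n
    using station[OF that] by (auto simp: charging_station_process_def finite_ctmc_def)
  have in_S: "Q n 0 \<omega> \<le> n * K" "Z n 0 \<omega> \<le> n * K" if "1 \<le> n" "\<omega> \<in> space (P n)" for n \<omega>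
    using measurable_space[OF X[OF that(1), of 0] that(2)] by (auto simp: station_states_def)
  have scaled: "0 \<le> real i / n \<and> real i / n \<le> K" if "1 \<le> n" "i \<le> n * K" for i n
  proof -
    have "real i \<le> real n * real K" using that(2) by (metis of_nat_le_iff of_nat_mult)
    then show ?thesis using that(1) by (simp add: divide_le_eq mult.commute)
  qed
  have meas0: "(\<lambda>\<omega>. g (Q n 0 \<omega>, Z n 0 \<omega>)) \<in> borel_measurable (P n)" if "1 \<le> n" for n and g :: "nat \<times> nat \<Rightarrow> real"
    using measurable_compose[OF X[OF that, of 0], of g borel] by simp
  have Q2: "(\<lambda>n. \<integral>\<omega>. (real (Q n 0 \<omega>) / n - K)\<^sup>2 \<partial>P n) \<longlonglongrightarrow> 0"
    by (rule weak_conv_const_imp_second_moment[OF P _ _ _ _ assms(10)])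
      (use meas0[where g = "\<lambda>x. real (fst x) / _"] scaled in_S in auto)
  have Z2: "(\<lambda>n. \<integral>\<omega>. (real (Z n 0 \<omega>) / n - z0)\<^sup>2 \<partial>P n) \<longlonglongrightarrow> 0"
    by (rule weak_conv_const_imp_second_moment[OF P _ _ _ _ assms(9)])
      (use meas0[where g = "\<lambda>x. real (snd x) / _"] scaled in_S assms(8) in auto)
  define B where "B n T = 3 * (\<integral>\<omega>. (real (Q n 0 \<omega>) / n - K)\<^sup>2 \<partial>P n)
    + 2 * (\<integral>\<omega>. (real (Z n 0 \<omega>) / n - z0)\<^sup>2 \<partial>P n) + (lam + mu * K + 2 * nu * K) * T / real n" for n :: nat and T
  have B: "(\<lambda>n. B n T) \<longlonglongrightarrow> 0" for T
  proof -
    have "(\<lambda>n. B n T) \<longlonglongrightarrow> 3 * 0 + 2 * 0 + 0"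
      unfolding B_def by (intro tendsto_intros Q2 Z2 lim_const_over_n)
    then show ?thesis by simp
  qed
  have initial: "(\<integral>\<omega>. deviation n (\<xi> 0) (\<xi> 0 - z 0) (Q n 0 \<omega>, Z n 0 \<omega>) \<partial>P n) + (lam + mu * K + 2 * nu * K) * T / n \<le> B n T"
    if n: "1 \<le> n" for n T
  proof -
    interpret prob_space "P n" by (rule P[OF n])
    have int: "integrable (P n) (\<lambda>\<omega>. g (Q n 0 \<omega>, Z n 0 \<omega>))" for g :: "nat \<times> nat \<Rightarrow> real"
      by (rule integrable_finite_valued[OF finite_station_states X[OF n order_refl]])
    have i1: "integrable (P n) (\<lambda>\<omega>. (real (Q n 0 \<omega>) / n - K)\<^sup>2)"
      using int[of "\<lambda>x. (real (fst x) / n - K)\<^sup>2"] by simp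
    have i2: "integrable (P n) (\<lambda>\<omega>. (real (Z n 0 \<omega>) / n - z0)\<^sup>2)"
      using int[of "\<lambda>x. (real (snd x) / n - z0)\<^sup>2"] by simp
    have "(\<integral>\<omega>. deviation n (\<xi> 0) (\<xi> 0 - z 0) (Q n 0 \<omega>, Z n 0 \<omega>) \<partial>P n)
        \<le> (\<integral>\<omega>. 3 * (real (Q n 0 \<omega>) / n - K)\<^sup>2 + 2 * (real (Z n 0 \<omega>) / n - z0)\<^sup>2 \<partial>P n)"
    proof (rule integral_mono)
      fix \<omega>
      let ?x = "real (Q n 0 \<omega>) / n - K" and ?y = "real (Z n 0 \<omega>) / n - z0"
      have "deviation n (\<xi> 0) (\<xi> 0 - z 0) (Q n 0 \<omega>, Z n 0 \<omega>) = ?x\<^sup>2 + (?x - ?y)\<^sup>2"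
        by (simp add: deviation_def \<xi>0 z0 diff_divide_distrib algebra_simps)
      also have "\<dots> \<le> 3 * ?x\<^sup>2 + 2 * ?y\<^sup>2"
      proof -
        have "a\<^sup>2 + (a - b)\<^sup>2 \<le> 3 * a\<^sup>2 + 2 * b\<^sup>2" for a b :: real
          using power2_diff_le[of a b] by simp
        then show ?thesis .
      qed
      finally show "deviation n (\<xi> 0) (\<xi> 0 - z 0) (Q n 0 \<omega>, Z n 0 \<omega>) \<le> 3 * ?x\<^sup>2 + 2 * ?y\<^sup>2" .
    qed (use int[of "deviation n (\<xi> 0) (\<xi> 0 - z 0)"] i1 i2 in auto)
    also have "\<dots> = 3 * (\<integral>\<omega>. (real (Q n 0 \<omega>) / n - K)\<^sup>2 \<partial>P n) + 2 * (\<integral>\<omega>. (real (Z n 0 \<omega>) / n - z0)\<^sup>2 \<partial>P n)"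
      using i1 i2 by simp
    finally show ?thesis by (simp add: B_def)
  qed
  have "process_conv_in_dist P (\<lambda>n t \<omega>. real (Z n t \<omega>) / real n) z"
    unfolding process_conv_in_dist_def
  proof (intro allI impI conjI)
    fix T :: real assume T: "0 < T"
    show meas: "path_on T (\<lambda>t \<omega>. real (Z n t \<omega>) / real n) \<in> measurable (P n) (borel_on (skorokhod_topology T))"
      if "1 \<le> n" for n
      using path_on_measurable[where X = "\<lambda>t \<omega>. (Q n t \<omega>, Z n t \<omega>)" and g = "\<lambda>x. real (snd x) / n",
          OF finite_station_states X[OF that] cadlag[OF that] open_singleton_nat_pair T] by simp
    have "continuous_on {0..T} z" using cont by (rule continuous_on_subset) auto
    then show z_in: "restrict z {0..T} \<in> skorokhod_space T" by (rule continuous_in_skorokhod_space)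
    show "weak_convergence_on (skorokhod_topology T)
        (\<lambda>n. path_law T (P n) (\<lambda>t \<omega>. real (Z n t \<omega>) / real n))
        (return (borel_on (skorokhod_topology T)) (restrict z {0..T}))"
    proof (rule path_law_converges_to_constant[OF T P meas z_in])
      fix e :: real assume e: "0 < e"
      define a where "a = e\<^sup>2 / 2 * exp (- 3 * mu * T)"
      have a: "0 < a" using e by (simp add: a_def)
      have "\<exists>E. E \<in> sets (P n) \<and> a * measure (P n) E \<le> B n T \<and>
          (\<forall>\<omega>\<in>space (P n) - E. \<forall>t\<in>{0..T}. \<bar>real (Z n t \<omega>) / n - z t\<bar> \<le> e)" if n: "1 \<le> n" for n
      proof -
        have "0 < n" using n by simp
        from station_deviation_maximal_inequality[where \<xi> = \<xi> and z = z,
            OF this assms(1,2,3,5,6) T e station[OF n] \<xi>[unfolded c_def] \<xi>K \<xi>_sat z[unfolded c_def]]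
        obtain E where E: "E \<in> sets (P n)"
          "e\<^sup>2 / 2 * exp (- 3 * mu * T) * measure (P n) E
            \<le> (\<integral>\<omega>. deviation n (\<xi> 0) (\<xi> 0 - z 0) (Q n 0 \<omega>, Z n 0 \<omega>) \<partial>P n)
              + (lam + mu * K + 2 * nu * K) * T / n"
          "\<And>\<omega> t. \<omega> \<in> space (P n) \<Longrightarrow> \<omega> \<notin> E \<Longrightarrow> t \<in> {0..T} \<Longrightarrow> \<bar>real (Z n t \<omega>) / n - z t\<bar> \<le> e"
          by blast
        show ?thesis
          unfolding a_def using order_trans[OF E(2) initial[OF n, of T]] E(1,3) by blast
      qed
      then obtain E where E: "\<And>n. 1 \<le> n \<Longrightarrow> E n \<in> sets (P n)" "\<And>n. 1 \<le> n \<Longrightarrow> a * measure (P n) (E n) \<le> B n T"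
        "\<And>n. 1 \<le> n \<Longrightarrow> \<forall>\<omega>\<in>space (P n) - E n. \<forall>t\<in>{0..T}. \<bar>real (Z n t \<omega>) / n - z t\<bar> \<le> e"
        by metis
      have "(\<lambda>n. measure (P n) (E n)) \<longlonglongrightarrow> 0"
      proof (rule tendsto_sandwich[OF _ _ tendsto_const])
        show "(\<lambda>n. B n T / a) \<longlonglongrightarrow> 0" using tendsto_divide[OF B[of T] tendsto_const[of a]] a by simp
        show "\<forall>\<^sub>F n in sequentially. measure (P n) (E n) \<le> B n T / a"
          using E(2) a by (intro eventually_sequentiallyI[of 1]) (simp add: le_divide_eq mult.commute)
      qed simp
      with E(1,3) show "\<exists>E. (\<forall>n\<ge>1. E n \<in> sets (P n)) \<and> (\<lambda>n. measure (P n) (E n)) \<longlonglongrightarrow> 0 \<and>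
          (\<forall>n\<ge>1. \<forall>\<omega>\<in>space (P n) - E n. \<forall>t\<in>{0..T}. \<bar>real (Z n t \<omega>) / n - z t\<bar> \<le> e)"
        by (intro exI[of _ E] conjI allI impI) simp_all
    qed
  qed
  moreover have "\<forall>t\<ge>0. z t \<in> {0..real K}" using z_range by simp
  moreover have "\<forall>t\<ge>0. (z has_real_derivative (min lam (nu * real K) - nu * z t - mu * min (z t) M)) (at t within {0..})"
    using has_field_derivative_at_within[OF z[unfolded c_def]] by simp
  ultimately show ?thesis using cont z0 by (intro exI[of _ z] conjI)
qed

end
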